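(* Let $C$ be a generic arrangement of $d\geq 4$ lines in $\mathbb{P}^2$ over $\mathbb{C}$. Then $C$ is a maximal Tjurina curve of type $(d,d-2)$.
   Context: A generic arrangement of $d$ lines in $\mathbb{P}^2$ is a union of $d$ distinct lines having only nodes as singularities, i.e. no three of the lines pass through a common point. Let $S=\mathbb{C}[x,y,z]$ with its standard grading, and let $C:f=0$ be a reduced curve of degree $d$ in the complex projective plane $\mathbb{P}^2$, with $f\in S$ homogeneous of degree $d$ and partial derivatives $f_x,f_y,f_z$. Let $$AR(f)=\{(a,b,c)\in S^3 : af_x+bf_y+cf_z=0\},$$ graded so that $(a,b,c)$ with $a,b,c$ homogeneous of degree $k$ has degree $k$, and let $mdr(f)$ be the minimal degree of a non-zero homogeneous element of $AR(f)$. The global Tjurina number $\tau(C)$ is the degree of the Jacobian ideal $J_f=(f_x,f_y,f_z)$ (i.e. $\dim_{\mathbb{C}}(S/J_f)_k$ for large $k$), equivalently the sum of the Tjurina numbers of all singular points of $C$. For integers $d,r$ with $d/2\leq r\leq d-1$ set $$\tau(d,r)_{max}=(d-1)(d-r-1)+r^2-\binom{2r-d+2}{2}.$$ A reduced plane curve $C:f=0$ is called a maximal Tjurina curve of type $(d,r)$ if $\deg f=d$, $mdr(f)=r$ and $\tau(C)=\tau(d,r)_{max}$. *)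

theory Defs
  imports
    "HOL-Analysis.Analysis"
    "HOL-Library.Poly_Mapping"
    "HOL-Computational_Algebra.Squarefree"
begin

section \<open>The polynomial ring in three variables\<close>

text \<open>
  \<open>S = \<complex>[x,y,z]\<close> is the monoid algebra of the exponent vectors \<open>3 \<Rightarrow>\<^sub>0 nat\<close>; the elements
  \<open>1, 2, 3\<close> of the index type index the variables \<open>x, y, z\<close>, and the ring structure is the
  convolution product of the library.
\<close>

type_synonym monomial = "3 \<Rightarrow>\<^sub>0 nat"
type_synonym poly3 = "monomial \<Rightarrow>\<^sub>0 complex"

definition mon_degree :: "monomial \<Rightarrow> nat" where
  "mon_degree m = (\<Sum>i\<in>UNIV. Poly_Mapping.lookup m i)"

text \<open>\<open>hom_part k\<close> is the graded piece \<open>S\<^sub>k\<close>; it contains \<open>0\<close> for every \<open>k\<close>.\<close>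

definition hom_part :: "nat \<Rightarrow> poly3 set" where
  "hom_part k = {p. \<forall>m\<in>Poly_Mapping.keys p. mon_degree m = k}"

definition const_poly :: "complex \<Rightarrow> poly3" where
  "const_poly c = Poly_Mapping.single 0 c"

definition poly_eval :: "poly3 \<Rightarrow> complex ^ 3 \<Rightarrow> complex" where
  "poly_eval p v =
     (\<Sum>m\<in>Poly_Mapping.keys p. Poly_Mapping.lookup p m * (\<Prod>i\<in>UNIV. v $ i ^ Poly_Mapping.lookup m i))"

text \<open>
  Subtraction of exponents is truncated, but the terms where the truncation
  matters have coefficient \<open>0\<close>.
\<close>

definition partial_deriv :: "3 \<Rightarrow> poly3 \<Rightarrow> poly3" where
  "partial_deriv i p =
     (\<Sum>m\<in>Poly_Mapping.keys p. Poly_Mapping.single (m - Poly_Mapping.single i 1)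
        (of_nat (Poly_Mapping.lookup m i) * Poly_Mapping.lookup p m))"


section \<open>Curves and line arrangements in the projective plane\<close>

text \<open>
  A subset of \<open>\<P>\<^sup>2\<close> is represented by the set of all homogeneous coordinate vectors
  of its points, i.e. by a scaling-invariant set of nonzero vectors of \<open>\<complex>\<^sup>3\<close>. Hence
  two subsets of \<open>\<P>\<^sup>2\<close> are equal iff their representations are, and they are
  disjoint iff their representations are.
\<close>

definition proj_zeros :: "poly3 \<Rightarrow> (complex ^ 3) set" where
  "proj_zeros f = {v. v \<noteq> 0 \<and> poly_eval f v = 0}"

definition proj_line :: "(complex ^ 3) set \<Rightarrow> bool" where
  "proj_line l \<longleftrightarrow> (\<exists>a :: complex ^ 3. a \<noteq> 0 \<and> l = {v. v \<noteq> 0 \<and> (\<Sum>i\<in>UNIV. a $ i * v $ i) = 0})"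

definition generic_line_arrangement :: "nat \<Rightarrow> (complex ^ 3) set \<Rightarrow> bool" where
  "generic_line_arrangement d C \<longleftrightarrow>
     (\<exists>L. finite L \<and> card L = d \<and> (\<forall>l\<in>L. proj_line l) \<and> C = \<Union>L \<and>
          (\<forall>l1\<in>L. \<forall>l2\<in>L. \<forall>l3\<in>L. l1 \<noteq> l2 \<and> l1 \<noteq> l3 \<and> l2 \<noteq> l3 \<longrightarrow> l1 \<inter> l2 \<inter> l3 = {}))"

text \<open>
  \<open>f\<close> defines a reduced plane curve of degree \<open>n\<close>; squarefreeness entails \<open>f \<noteq> 0\<close>,
  so that \<open>n\<close> is the degree of \<open>f\<close>.
\<close>

definition reduced_plane_curve :: "nat \<Rightarrow> poly3 \<Rightarrow> bool" where
  "reduced_plane_curve n f \<longleftrightarrow> 1 \<le> n \<and> f \<in> hom_part n \<and> squarefree f"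


section \<open>Jacobian syzygies and the global Tjurina number\<close>

definition AR :: "poly3 \<Rightarrow> (poly3 ^ 3) set" where
  "AR f = {a. (\<Sum>i\<in>UNIV. a $ i * partial_deriv i f) = 0}"

definition mdr :: "poly3 \<Rightarrow> nat" where
  "mdr f = (LEAST k. \<exists>a\<in>AR f. a \<noteq> 0 \<and> (\<forall>i. a $ i \<in> hom_part k))"

definition jacobian_ideal :: "poly3 \<Rightarrow> poly3 set" where
  "jacobian_ideal f = {\<Sum>i\<in>UNIV. a $ i * partial_deriv i f | a :: poly3 ^ 3. True}"

text \<open>
  The residue classes modulo \<open>W\<close> of the finitely many elements of \<open>B \<subseteq> V\<close> are distinct
  and form a \<open>\<complex>\<close>-basis of the image of \<open>V\<close> in the quotient by \<open>W\<close>: every class is a unique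
  linear combination of them. (The coefficient function is fixed to be \<open>0\<close> outside \<open>B\<close>
  so that uniqueness is meaningful.)
\<close>

definition basis_modulo :: "poly3 set \<Rightarrow> poly3 set \<Rightarrow> poly3 set \<Rightarrow> bool" where
  "basis_modulo W V B \<longleftrightarrow> finite B \<and> B \<subseteq> V \<and>
     (\<forall>v\<in>V. \<exists>!c :: poly3 \<Rightarrow> complex.
        (\<forall>b. b \<notin> B \<longrightarrow> c b = 0) \<and> v - (\<Sum>b\<in>B. const_poly (c b) * b) \<in> W)"

text \<open>\<open>dim\<^sub>\<complex> (S/J)\<^sub>k\<close>, where \<open>(S/J)\<^sub>k\<close> is the image of \<open>S\<^sub>k\<close> in \<open>S/J\<close>.\<close>

definition hilbert_function :: "poly3 set \<Rightarrow> nat \<Rightarrow> nat" where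
  "hilbert_function J k = (THE n. \<exists>B. basis_modulo J (hom_part k) B \<and> card B = n)"

text \<open>The degree of the Jacobian ideal: the value of \<open>dim\<^sub>\<complex> (S/J\<^sub>f)\<^sub>k\<close> for all large \<open>k\<close>.\<close>

definition global_tjurina :: "poly3 \<Rightarrow> nat" where
  "global_tjurina f =
     (THE t. eventually (\<lambda>k. hilbert_function (jacobian_ideal f) k = t) sequentially)"


section \<open>Maximal Tjurina curves\<close>

text \<open>Only meant for \<open>d/2 \<le> r \<le> d - 1\<close>, where the truncated subtraction is exact.\<close>

definition tjurina_max :: "nat \<Rightarrow> nat \<Rightarrow> int" where
  "tjurina_max d r =
     (int d - 1) * (int d - int r - 1) + (int r)\<^sup>2 - int ((2 * r + 2 - d) choose 2)"

definition maximal_tjurina_curve :: "nat \<Rightarrow> nat \<Rightarrow> poly3 \<Rightarrow> bool" where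
  "maximal_tjurina_curve d r f \<longleftrightarrow>
     d \<le> 2 * r \<and> r + 1 \<le> d \<and>
     reduced_plane_curve d f \<and> mdr f = r \<and> int (global_tjurina f) = tjurina_max d r"

end

theory Submission
  imports Defs "HOL-Computational_Algebra.Fundamental_Theorem_Algebra" "HOL-Library.Function_Algebras"
begin

text \<open>
  Restricting \<open>f\<close> to its lines shows that \<open>f = l\<^sub>1 \<cdots> l\<^sub>d\<close> up to a cofactor, which has to be constant because
  otherwise it would have a zero on a general line. Put \<open>g\<^sub>i = f / l\<^sub>i\<close> and \<open>g\<^sub>i\<^sub>j = f / (l\<^sub>i l\<^sub>j)\<close>.

  The Jacobian ideal \<open>J\<close> contains \<open>f\<close> by Euler's identity and \<open>\<partial>\<^sub>v f = \<Sum>\<^sub>i l\<^sub>i(v) g\<^sub>i\<close> for all \<open>v\<close>. Multiplying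
  by \<open>g\<^sub>i\<^sub>j\<close>, with \<open>l\<^sub>i(v) = 1\<close> and \<open>l\<^sub>j(v) = 0\<close>, gives \<open>g\<^sub>i g\<^sub>i\<^sub>j \<in> J\<close>. On the line \<open>l\<^sub>i = 0\<close> the \<open>d - 1\<close> forms
  \<open>g\<^sub>i\<^sub>j\<close> are the Lagrange basis of the binary forms of degree \<open>d - 2\<close>, whence \<open>g\<^sub>i S\<^sub>k \<subseteq> J\<close> for \<open>k \<ge> d - 2\<close>.
  A form vanishing at all nodes lies in the ideal of the \<open>g\<^sub>i\<close> (peel off one line at a time), so in degrees
  \<open>k \<ge> 2d - 3\<close> the ideal \<open>J\<close> consists of the forms vanishing at the \<open>d (d - 1) / 2\<close> nodes, and these impose
  independent conditions.

  If \<open>D f = 0\<close> for a derivation \<open>D\<close> with coefficients of degree \<open>k < d - 2\<close>, then \<open>D l\<^sub>i = e\<^sub>i l\<^sub>i\<close> and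
  \<open>\<Sum>\<^sub>i e\<^sub>i = 0\<close>. The differences \<open>e\<^sub>m - e\<^sub>n\<close> vanish at all nodes of the other \<open>d - 2\<close> lines, so they are
  zero for degree reasons; hence all \<open>e\<^sub>i\<close> and \<open>D\<close> vanish. A syzygy of degree \<open>d - 2\<close> comes from
  \<open>g\<^sub>i\<^sub>j \<partial>\<^sub>p\<close>, where \<open>p\<close> is the node of the lines \<open>i\<close> and \<open>j\<close>.
\<close>

section \<open>The graded polynomial ring\<close>

lemma sum_monomials:
  "(\<Sum>m\<in>Poly_Mapping.keys p. Poly_Mapping.single m (Poly_Mapping.lookup p m)) = p"
  by (rule poly_mapping_eqI) (simp add: lookup_sum lookup_single when_def in_keys_iff)

text \<open>Polynomials are finite sums of terms, so identities that are additive in each argument,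
  such as the Leibniz rule, need checking only on single terms.\<close>

lemma poly_mapping_induct [case_names single add]:
  fixes p :: "'a \<Rightarrow>\<^sub>0 'b::comm_monoid_add"
  assumes single: "\<And>m c. P (Poly_Mapping.single m c)"
    and add: "\<And>p q. P p \<Longrightarrow> P q \<Longrightarrow> P (p + q)"
  shows "P p"
proof -
  have "P (\<Sum>m\<in>A. Poly_Mapping.single m (Poly_Mapping.lookup p m))" if "finite A" for A
    using that
  proof induction
    case empty
    show ?case using single[of undefined 0] by simp
  qed (simp add: single add)
  then show ?thesis by (metis sum_monomials finite_keys)
qed

lemma mon_degree_add: "mon_degree (m + n) = mon_degree m + mon_degree n"
  by (simp add: mon_degree_def lookup_add sum.distrib)

lemma mon_degree_zero [simp]: "mon_degree 0 = 0"
  by (simp add: mon_degree_def)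

lemma mon_degree_single [simp]: "mon_degree (Poly_Mapping.single i e) = e"
  by (simp add: mon_degree_def lookup_single when_def)

lemma mon_degree_eq_0_iff: "mon_degree m = 0 \<longleftrightarrow> m = 0"
  by (auto simp: mon_degree_def poly_mapping_eq_iff fun_eq_iff)

text \<open>The grading is indexed by integers so that degrees can be subtracted freely:
  \<open>hom k\<close> is \<open>{0}\<close> for negative \<open>k\<close>.\<close>

definition hom :: "int \<Rightarrow> poly3 set" where
  "hom k = {p. \<forall>m\<in>Poly_Mapping.keys p. int (mon_degree m) = k}"

lemma hom_part_eq_hom: "hom_part k = hom (int k)"
  by (simp add: hom_part_def hom_def)

lemma hom_negD: "p \<in> hom k \<Longrightarrow> k < 0 \<Longrightarrow> p = 0"
  by (force simp: hom_def simp flip: keys_eq_empty)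

lemma hom_0 [simp]: "0 \<in> hom k"
  by (simp add: hom_def)

lemma hom_add: "p \<in> hom k \<Longrightarrow> q \<in> hom k \<Longrightarrow> p + q \<in> hom k"
  using keys_add[of p q] by (auto simp: hom_def)

lemma hom_mult: "p \<in> hom k \<Longrightarrow> q \<in> hom l \<Longrightarrow> p * q \<in> hom (k + l)"
  using keys_mult[of p q] by (force simp: hom_def mon_degree_add)

lemma hom_mult': "p \<in> hom k \<Longrightarrow> q \<in> hom l \<Longrightarrow> n = k + l \<Longrightarrow> p * q \<in> hom n"
  by (simp add: hom_mult)

lemma hom_const: "const_poly c \<in> hom 0"
  by (auto simp: hom_def const_poly_def split: if_splits)

lemma hom_const_mult: "p \<in> hom k \<Longrightarrow> const_poly c * p \<in> hom k"
  using hom_mult[OF hom_const] by simp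

lemma hom_1 [simp]: "1 \<in> hom 0"
  by (simp add: hom_def)

lemma hom_uminus: "p \<in> hom k \<Longrightarrow> - p \<in> hom k"
  by (simp add: hom_def in_keys_iff)

lemma hom_diff: "p \<in> hom k \<Longrightarrow> q \<in> hom k \<Longrightarrow> p - q \<in> hom k"
  using hom_add[OF _ hom_uminus, of p k q] by simp

lemma hom_sum: "(\<And>x. x \<in> A \<Longrightarrow> p x \<in> hom k) \<Longrightarrow> sum p A \<in> hom k"
  by (induction A rule: infinite_finite_induct) (auto intro: hom_add)

lemma hom_power: "p \<in> hom k \<Longrightarrow> p ^ n \<in> hom (int n * k)"
  by (induction n) (auto intro: hom_mult simp: algebra_simps)

lemma hom_0_const: assumes "p \<in> hom 0" shows "\<exists>c. p = const_poly c"
proof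
  have "m = 0" if "m \<in> Poly_Mapping.keys p" for m
    using that assms by (auto simp: hom_def mon_degree_eq_0_iff)
  then show "p = const_poly (Poly_Mapping.lookup p 0)"
    by (intro poly_mapping_eqI) (auto simp: const_poly_def lookup_single when_def in_keys_iff)
qed

lemma const_poly_0 [simp]: "const_poly 0 = 0"
  by (simp add: const_poly_def)

lemma const_poly_1 [simp]: "const_poly 1 = 1"
  by (simp add: const_poly_def)

lemma const_poly_eq_0_iff [simp]: "const_poly c = 0 \<longleftrightarrow> c = 0"
  by (metis const_poly_def const_poly_0 inj_single injD)

lemma const_poly_add: "const_poly (a + b) = const_poly a + const_poly b"
  by (simp add: const_poly_def single_add)

lemma const_poly_mult: "const_poly (a * b) = const_poly a * const_poly b"
  by (simp add: const_poly_def mult_single)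

lemma const_poly_sum: "const_poly (\<Sum>x\<in>A. g x) = (\<Sum>x\<in>A. const_poly (g x))"
  by (induction A rule: infinite_finite_induct) (auto simp: const_poly_add)

lemma const_poly_of_nat: "const_poly (of_nat n) = of_nat n"
  by (induction n) (simp_all add: const_poly_add)

section \<open>Linear forms and variables\<close>

definition lform :: "complex ^ 3 \<Rightarrow> poly3" where
  "lform a = (\<Sum>i\<in>UNIV. Poly_Mapping.single (Poly_Mapping.single i 1) (a $ i))"

definition var :: "3 \<Rightarrow> poly3" where
  "var i = lform (axis i 1)"

definition dot :: "complex ^ 3 \<Rightarrow> complex ^ 3 \<Rightarrow> complex" where
  "dot a v = (\<Sum>i\<in>UNIV. a $ i * v $ i)"

lemma dot_add: "dot a (v + w) = dot a v + dot a w"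
  and dot_diff: "dot a (v - w) = dot a v - dot a w"
  and dot_diff_left: "dot (a - b) v = dot a v - dot b v"
  and dot_scale: "dot a (c *s v) = c * dot a v"
  and dot_scale_left: "dot (c *s a) v = c * dot a v"
  and dot_0 [simp]: "dot a 0 = 0"
  and dot_0_left [simp]: "dot 0 a = 0"
  and dot_axis: "dot (axis i c) v = c * v $ i"
  by (simp_all add: dot_def algebra_simps sum.distrib sum_distrib_left sum_subtractf axis_def
      if_distrib[of "\<lambda>x. x * _"] if_distrib[of "\<lambda>x. _ * x"] cong: if_cong)

lemma var_eq: "var i = Poly_Mapping.single (Poly_Mapping.single i 1) 1"
proof -
  have "var i = (\<Sum>j\<in>UNIV. if j = i then Poly_Mapping.single (Poly_Mapping.single i 1) 1 else 0)"
    unfolding var_def lform_def by (rule sum.cong) (auto simp: axis_def)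
  then show ?thesis by simp
qed

lemma hom_lform: "lform a \<in> hom 1"
  unfolding lform_def by (rule hom_sum) (auto simp: hom_def split: if_splits)

lemma hom_lform_mult: "p \<in> hom (k - 1) \<Longrightarrow> lform a * p \<in> hom k"
  using hom_mult[OF hom_lform] by force

lemma hom_prod_lform: "finite A \<Longrightarrow> (\<Prod>i\<in>A. lform (a i)) \<in> hom (int (card A))"
  by (induction A rule: finite_induct) (auto intro: hom_mult' hom_lform)

lemma lform_scale: "lform (c *s a) = const_poly c * lform a"
  by (simp add: lform_def const_poly_def sum_distrib_left mult_single)

lemma lform_add: "lform (a + b) = lform a + lform b"
  by (simp add: lform_def single_add sum.distrib)

lemma lform_eq_sum: "lform a = (\<Sum>i\<in>UNIV. const_poly (a $ i) * var i)"
  by (simp add: lform_def const_poly_def var_eq mult_single)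

text \<open>Monomials of positive degree are divisible by a variable.\<close>

lemma hom_part_induct [consumes 1, case_names zero add const var]:
  assumes "p \<in> hom (int k)"
    and zero: "\<And>k. P k 0"
    and add: "\<And>k p q. P k p \<Longrightarrow> P k q \<Longrightarrow> P k (p + q)"
    and const: "\<And>c. P 0 (const_poly c)"
    and var: "\<And>k i p. p \<in> hom (int k) \<Longrightarrow> P k p \<Longrightarrow> P (Suc k) (var i * p)"
  shows "P k p"
proof -
  have monom: "P (mon_degree m) (Poly_Mapping.single m c)" for m c
  proof (induction "mon_degree m" arbitrary: m)
    case 0
    then have "m = 0" by (metis mon_degree_eq_0_iff)
    with const[of c] show ?case by (simp add: const_poly_def)
  next
    case (Suc n)
    have "\<exists>i. Poly_Mapping.lookup m i \<noteq> 0"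
      using Suc.hyps(2) by (metis mon_degree_def sum.neutral nat.distinct(1))
    then obtain i where i: "Poly_Mapping.lookup m i \<noteq> 0" by blast
    define m' where "m' = m - Poly_Mapping.single i 1"
    have m: "m = Poly_Mapping.single i 1 + m'"
      by (rule poly_mapping_eqI) (use i in \<open>auto simp: m'_def lookup_add lookup_minus lookup_single when_def\<close>)
    have "mon_degree m = Suc (mon_degree m')"
      by (subst m) (simp add: mon_degree_add)
    with Suc have "P n (Poly_Mapping.single m' c)" by simp
    moreover have "Poly_Mapping.single m c = var i * Poly_Mapping.single m' c"
      by (subst m) (simp add: var_eq mult_single)
    moreover have "Poly_Mapping.single m' c \<in> hom (int n)"
      using Suc.hyps(2) \<open>mon_degree m = Suc (mon_degree m')\<close> by (simp add: hom_def)
    ultimately show ?case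
      using var[of "Poly_Mapping.single m' c" n i] by (simp add: Suc.hyps(2)[symmetric])
  qed
  have "P k (\<Sum>m\<in>A. Poly_Mapping.single m (Poly_Mapping.lookup p m))"
    if "finite A" "A \<subseteq> Poly_Mapping.keys p" for A
    using that
  proof induction
    case (insert m A)
    then have "mon_degree m = k" using assms(1) by (auto simp: hom_def)
    with insert monom[of m] show ?case by (auto intro: add)
  qed (simp add: zero)
  then show ?thesis by (metis sum_monomials finite_keys order_refl)
qed

section \<open>Evaluation at vectors\<close>

lemma poly_eval_single [simp]:
  "poly_eval (Poly_Mapping.single m c) v = c * (\<Prod>i\<in>UNIV. v $ i ^ Poly_Mapping.lookup m i)"
  by (simp add: poly_eval_def)

lemma poly_eval_0 [simp]: "poly_eval 0 v = 0"
  by (simp add: poly_eval_def)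

lemma poly_eval_add: "poly_eval (p + q) v = poly_eval p v + poly_eval q v"
  unfolding poly_eval_def
  by (rule setsum_keys_plus_distrib) (simp_all add: algebra_simps)

lemma poly_eval_mult: "poly_eval (p * q) v = poly_eval p v * poly_eval q v"
proof (induction p rule: poly_mapping_induct)
  case (single m c)
  show ?case
  proof (induction q rule: poly_mapping_induct)
    case (single n d)
    then show ?case
      by (simp add: mult_single lookup_add power_add prod.distrib)
  qed (simp add: algebra_simps poly_eval_add)
qed (simp add: algebra_simps poly_eval_add)

lemma poly_eval_const [simp]: "poly_eval (const_poly c) v = c"
  by (simp add: const_poly_def)

lemma poly_eval_1 [simp]: "poly_eval 1 v = 1"
  using poly_eval_const[of 1] by simp

lemma poly_eval_diff: "poly_eval (p - q) v = poly_eval p v - poly_eval q v"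
  using poly_eval_add[of "p - q" q v] by simp

lemma poly_eval_sum: "poly_eval (\<Sum>x\<in>A. p x) v = (\<Sum>x\<in>A. poly_eval (p x) v)"
  by (induction A rule: infinite_finite_induct) (auto simp: poly_eval_add)

lemma poly_eval_prod: "poly_eval (\<Prod>x\<in>A. p x) v = (\<Prod>x\<in>A. poly_eval (p x) v)"
  by (induction A rule: infinite_finite_induct) (auto simp: poly_eval_mult)

lemma poly_eval_power: "poly_eval (p ^ n) v = poly_eval p v ^ n"
  by (induction n) (auto simp: poly_eval_mult)

lemma poly_eval_var [simp]: "poly_eval (var i) v = v $ i"
proof -
  have "(\<Prod>j\<in>UNIV. v $ j ^ Poly_Mapping.lookup (Poly_Mapping.single i 1) j) =
    (\<Prod>j\<in>UNIV. if j = i then v $ i else 1)"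
    by (rule prod.cong) (auto simp: lookup_single when_def)
  then show ?thesis by (simp add: var_eq)
qed

lemma poly_eval_lform [simp]: "poly_eval (lform a) v = dot a v"
  by (simp add: lform_eq_sum poly_eval_sum poly_eval_mult dot_def)

lemmas poly_eval_simps = poly_eval_add poly_eval_mult poly_eval_diff poly_eval_sum poly_eval_prod
  poly_eval_power

lemma poly_eval_scale:
  assumes "p \<in> hom (int k)"
  shows "poly_eval p (c *s v) = c ^ k * poly_eval p v"
  using assms by (induction rule: hom_part_induct) (simp_all add: poly_eval_simps algebra_simps)

lemma poly_eval_line: "\<exists>P. \<forall>t. poly P t = poly_eval p (v + t *s w)"
proof (induction p rule: poly_mapping_induct)
  case (single m c)
  show ?case
    by (rule exI[of _ "smult c (\<Prod>i\<in>UNIV. [:v $ i, w $ i:] ^ Poly_Mapping.lookup m i)"])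
      (simp add: poly_prod)
next
  case (add p q)
  then obtain P Q where "\<forall>t. poly P t = poly_eval p (v + t *s w)" "\<forall>t. poly Q t = poly_eval q (v + t *s w)"
    by blast
  then show ?case by (intro exI[of _ "P + Q"]) (simp add: poly_eval_add)
qed

section \<open>Formal partial derivatives\<close>

lemma partial_deriv_single:
  "partial_deriv i (Poly_Mapping.single m c) =
    Poly_Mapping.single (m - Poly_Mapping.single i 1) (of_nat (Poly_Mapping.lookup m i) * c)"
  by (simp add: partial_deriv_def)

lemma partial_deriv_add: "partial_deriv i (p + q) = partial_deriv i p + partial_deriv i q"
  unfolding partial_deriv_def
  by (rule setsum_keys_plus_distrib) (simp_all add: algebra_simps single_add)

lemma partial_deriv_mult:
  "partial_deriv i (p * q) = partial_deriv i p * q + p * partial_deriv i q"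
proof (induction p rule: poly_mapping_induct)
  case (single m c)
  show ?case
  proof (induction q rule: poly_mapping_induct)
    case (single n d)
    \<comment> \<open>The exponents agree unless the subtraction is truncated, and then the
      coefficient is 0 on both sides.\<close>
    have 1: "Poly_Mapping.single (m - Poly_Mapping.single i 1 + n)
        (of_nat (Poly_Mapping.lookup m i) * c * d) =
      Poly_Mapping.single (m + n - Poly_Mapping.single i 1) (of_nat (Poly_Mapping.lookup m i) * c * d)"
    proof (cases "Poly_Mapping.lookup m i = 0")
      case False
      then have "m - Poly_Mapping.single i 1 + n = m + n - Poly_Mapping.single i 1"
        by (intro poly_mapping_eqI) (auto simp: lookup_add lookup_minus lookup_single when_def)
      then show ?thesis by simp
    qed simp
    have 2: "Poly_Mapping.single (m + (n - Poly_Mapping.single i 1))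
        (c * (of_nat (Poly_Mapping.lookup n i) * d)) =
      Poly_Mapping.single (m + n - Poly_Mapping.single i 1) (c * (of_nat (Poly_Mapping.lookup n i) * d))"
    proof (cases "Poly_Mapping.lookup n i = 0")
      case False
      then have "m + (n - Poly_Mapping.single i 1) = m + n - Poly_Mapping.single i 1"
        by (intro poly_mapping_eqI) (auto simp: lookup_add lookup_minus lookup_single when_def)
      then show ?thesis by simp
    qed simp
    show ?case
      using 1 2 by (simp add: partial_deriv_single mult_single lookup_add algebra_simps flip: single_add)
  qed (simp add: algebra_simps partial_deriv_add)
qed (simp add: algebra_simps partial_deriv_add)

lemma partial_deriv_1 [simp]: "partial_deriv i 1 = 0"
  by (simp add: partial_deriv_single flip: single_one)

lemma partial_deriv_lform [simp]: "partial_deriv i (lform a) = const_poly (a $ i)"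
proof -
  have sum: "partial_deriv i (\<Sum>x\<in>A. g x) = (\<Sum>x\<in>A. partial_deriv i (g x))" for A :: "3 set" and g
    by (induction A rule: infinite_finite_induct)
      (simp_all add: partial_deriv_add, simp add: partial_deriv_def)
  have "partial_deriv i (lform a) = (\<Sum>j\<in>UNIV. if j = i then const_poly (a $ i) else 0)"
    unfolding lform_def sum
    by (rule sum.cong) (auto simp: partial_deriv_single const_poly_def lookup_single when_def)
  then show ?thesis by simp
qed

lemma partial_deriv_prod_lform:
  assumes "finite A"
  shows "partial_deriv s (\<Prod>i\<in>A. lform (a i)) =
    (\<Sum>i\<in>A. const_poly (a i $ s) * (\<Prod>j\<in>A - {i}. lform (a j)))"
  using assms
proof (induction A rule: finite_induct)
  case (insert x A)
  have "(\<Sum>i\<in>A. const_poly (a i $ s) * (\<Prod>j\<in>insert x A - {i}. lform (a j))) =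
      lform (a x) * (\<Sum>i\<in>A. const_poly (a i $ s) * (\<Prod>j\<in>A - {i}. lform (a j)))"
    unfolding sum_distrib_left
  proof (rule sum.cong)
    fix i assume i: "i \<in> A"
    then have "insert x A - {i} = insert x (A - {i})" using insert by auto
    then show "const_poly (a i $ s) * (\<Prod>j\<in>insert x A - {i}. lform (a j)) =
      lform (a x) * (const_poly (a i $ s) * (\<Prod>j\<in>A - {i}. lform (a j)))"
      using insert by (simp add: algebra_simps)
  qed simp
  moreover have "insert x A - {x} = A" using insert by auto
  ultimately show ?case using insert by (simp add: partial_deriv_mult)
qed simp

section \<open>Forms vanishing at points of a line\<close>

text \<open>This is linear independence of three covectors, phrased through their kernel so that it
  matches three lines without a common point.\<close>

definition tri :: "complex ^ 3 \<Rightarrow> complex ^ 3 \<Rightarrow> complex ^ 3 \<Rightarrow> bool" where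
  "tri a b c \<longleftrightarrow> (\<forall>v. dot a v = 0 \<and> dot b v = 0 \<and> dot c v = 0 \<longrightarrow> v = 0)"

lemma tri_rotate: "tri a b c \<Longrightarrow> tri b c a"
  unfolding tri_def by blast

lemma matrix_vector_mult_vector:
  "((vector [a, b, c] :: complex ^ 3 ^ 3) *v x) $ 1 = dot a x"
  "((vector [a, b, c] :: complex ^ 3 ^ 3) *v x) $ 2 = dot b x"
  "((vector [a, b, c] :: complex ^ 3 ^ 3) *v x) $ 3 = dot c x"
  for x :: "complex ^ 3"
  by (simp_all add: matrix_vector_mult_def dot_def)

lemma tri_matrix:
  assumes "tri a b c"
  obtains B :: "complex ^ 3 ^ 3" where "B ** (vector [a, b, c] :: complex ^ 3 ^ 3) = mat 1" "(vector [a, b, c] :: complex ^ 3 ^ 3) ** B = mat 1"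
proof -
  have "\<forall>x. (vector [a, b, c] :: complex ^ 3 ^ 3) *v x = 0 \<longrightarrow> x = 0"
  proof (intro allI impI)
    fix x assume "(vector [a, b, c] :: complex ^ 3 ^ 3) *v x = 0"
    then have "dot a x = 0" "dot b x = 0" "dot c x = 0"
      by (metis matrix_vector_mult_vector zero_index)+
    with assms show "x = 0" by (simp add: tri_def)
  qed
  then show ?thesis
    using that matrix_left_invertible_ker matrix_left_right_inverse by metis
qed

text \<open>The vector is the first column of the inverse of the matrix with rows \<open>a\<close>,
  \<open>b\<close>, \<open>c\<close>, hence a dual basis vector.\<close>

lemma tri_dual:
  assumes "tri a b c"
  obtains v where "dot a v = 1" "dot b v = 0" "dot c v = 0"
proof -
  obtain B :: "complex ^ 3 ^ 3" where "(vector [a, b, c] :: complex ^ 3 ^ 3) ** B = mat 1"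
    using tri_matrix[OF assms] by blast
  then have "(vector [a, b, c] :: complex ^ 3 ^ 3) *v (B *v axis 1 1) = axis 1 1"
    by (simp only: matrix_vector_mul_assoc matrix_vector_mul_lid)
  then show ?thesis
    using matrix_vector_mult_vector[of a b c "B *v axis 1 1"]
    by (intro that[of "B *v axis 1 1"]) (simp_all add: axis_def)
qed

lemma tri_span:
  assumes "tri a b c"
  obtains \<alpha> \<beta> \<gamma> where "e = \<alpha> *s a + \<beta> *s b + \<gamma> *s c"
proof -
  obtain B :: "complex ^ 3 ^ 3" where "B ** (vector [a, b, c] :: complex ^ 3 ^ 3) = mat 1"
    using tri_matrix[OF assms] by blast
  then have "(e v* B) v* (vector [a, b, c] :: complex ^ 3 ^ 3) = e"
    by (simp add: vector_matrix_mul_assoc)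
  then have "e = (e v* B) $ 1 *s a + (e v* B) $ 2 *s b + (e v* B) $ 3 *s c"
    by (subst (asm) vector_matrix_mult_def) (simp add: vec_eq_iff sum_3 algebra_simps)
  then show ?thesis by (rule that)
qed

lemma tri_exists: assumes "a \<noteq> 0" obtains b c where "tri a b c"
proof -
  have "a $ 1 \<noteq> 0 \<or> a $ 2 \<noteq> 0 \<or> a $ 3 \<noteq> 0"
    using assms by (auto simp: vec_eq_iff forall_3)
  moreover have "tri a (axis 2 1) (axis 3 1)" if "a $ 1 \<noteq> 0"
    using that unfolding tri_def dot_axis by (auto simp: vec_eq_iff forall_3 dot_def sum_3)
  moreover have "tri a (axis 1 1) (axis 3 1)" if "a $ 2 \<noteq> 0"
    using that unfolding tri_def dot_axis by (auto simp: vec_eq_iff forall_3 dot_def sum_3)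
  moreover have "tri a (axis 1 1) (axis 2 1)" if "a $ 3 \<noteq> 0"
    using that unfolding tri_def dot_axis by (auto simp: vec_eq_iff forall_3 dot_def sum_3)
  ultimately show ?thesis using that by blast
qed

lemma tri_eqI:
  "tri a b c \<Longrightarrow> dot a v = dot a w \<Longrightarrow> dot b v = dot b w \<Longrightarrow> dot c v = dot c w \<Longrightarrow> v = w"
  unfolding tri_def by (metis dot_diff right_minus_eq)

text \<open>In the linear coordinates \<open>a\<close>, \<open>b\<close>, \<open>c\<close> the only
  monomial of degree \<open>k\<close> outside the ideal of the first two is the pure power of the
  third. Integer degrees let \<open>u\<close> and \<open>w\<close> be 0 when
  \<open>k = 0\<close>.\<close>

lemma hom_reduce:
  assumes "tri a b c" "p \<in> hom (int k)"
  shows "\<exists>s u w. p = const_poly s * lform c ^ k + lform a * u + lform b * w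
    \<and> u \<in> hom (int k - 1) \<and> w \<in> hom (int k - 1)"
  using assms(2)
proof (induction rule: hom_part_induct)
  case (zero k)
  show ?case by (rule exI[of _ 0] exI[of _ "0 :: poly3"])+ simp
next
  case (add k p q)
  then obtain s u w s' u' w' where
    "p = const_poly s * lform c ^ k + lform a * u + lform b * w"
    "q = const_poly s' * lform c ^ k + lform a * u' + lform b * w'"
    "u \<in> hom (int k - 1)" "w \<in> hom (int k - 1)" "u' \<in> hom (int k - 1)" "w' \<in> hom (int k - 1)"
    by blast
  then show ?case
    by (intro exI[of _ "s + s'"] exI[of _ "u + u'"] exI[of _ "w + w'"])
      (auto simp: const_poly_add algebra_simps hom_add)
next
  case (const s)
  show ?case by (rule exI[of _ s], rule exI[of _ 0], rule exI[of _ 0]) simp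
next
  case (var k i p)
  then obtain s u w where p: "p = const_poly s * lform c ^ k + lform a * u + lform b * w"
    and uw: "u \<in> hom (int k - 1)" "w \<in> hom (int k - 1)"
    by blast
  obtain \<alpha> \<beta> \<gamma> where "axis i 1 = \<alpha> *s a + \<beta> *s b + \<gamma> *s c"
    using tri_span[OF assms(1)] by blast
  then have "var i = const_poly \<alpha> * lform a + const_poly \<beta> * lform b + const_poly \<gamma> * lform c"
    by (simp add: var_def lform_add lform_scale)
  then have "var i * p = const_poly \<alpha> * lform a * p + const_poly \<beta> * lform b * p
      + const_poly \<gamma> * (lform c * p)"
    by (simp add: algebra_simps)
  also have "lform c * p = const_poly s * lform c ^ Suc k + lform a * (lform c * u) + lform b * (lform c * w)"
    by (simp add: p algebra_simps)
  finally have "var i * p = const_poly (\<gamma> * s) * lform c ^ Suc k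
      + lform a * (const_poly \<alpha> * p + const_poly \<gamma> * (lform c * u))
      + lform b * (const_poly \<beta> * p + const_poly \<gamma> * (lform c * w))"
    by (simp add: algebra_simps const_poly_mult)
  moreover have "const_poly \<alpha> * p + const_poly \<gamma> * (lform c * u) \<in> hom (int (Suc k) - 1)"
    "const_poly \<beta> * p + const_poly \<gamma> * (lform c * w) \<in> hom (int (Suc k) - 1)"
    using uw var(1) by (auto intro!: hom_add hom_const_mult hom_lform_mult)
  ultimately show ?case by blast
qed

text \<open>Two independent linear forms generate the ideal of their common point: evaluation at
  \<open>v\<close> leaves only the pure power of \<open>c\<close>, and \<open>dot c v\<close> is
  nonzero.\<close>

lemma hom_vanish_point:
  assumes tri: "tri a b c" and v: "v \<noteq> 0" "dot a v = 0" "dot b v = 0"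
    and h: "h \<in> hom k" "poly_eval h v = 0"
  obtains u w where "h = lform a * u + lform b * w" "u \<in> hom (k - 1)" "w \<in> hom (k - 1)"
proof (cases "k < 0")
  case True
  then have "h = 0" using hom_negD h by blast
  then show ?thesis using that[of 0 0] by simp
next
  case False
  then have "h \<in> hom (int (nat k))" using h by simp
  from hom_reduce[OF tri this] False obtain s u w where
    d: "h = const_poly s * lform c ^ nat k + lform a * u + lform b * w"
    and uw: "u \<in> hom (k - 1)" "w \<in> hom (k - 1)" by auto
  have "dot c v \<noteq> 0" using tri v by (auto simp: tri_def)
  moreover have "s * dot c v ^ nat k = 0"
    using h(2) v by (simp add: d poly_eval_simps)
  ultimately have "s = 0" by simp
  with d uw show ?thesis using that by simp
qed

lemma hom_value:
  assumes "v \<noteq> 0" "0 \<le> k"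
  obtains s where "s \<in> hom k" "poly_eval s v = c"
proof -
  obtain i where i: "v $ i \<noteq> 0" using assms by (auto simp: vec_eq_iff)
  have "const_poly (c / v $ i ^ nat k) * var i ^ nat k \<in> hom k"
    using hom_power[OF hom_lform, of "axis i 1" "nat k"] assms by (auto simp: var_def intro: hom_const_mult)
  then show ?thesis by (rule that) (use i in \<open>simp add: poly_eval_simps\<close>)
qed

text \<open>The lines \<open>m j\<close> cut the line \<open>a\<close> in distinct points
  \<open>v j\<close>. The condition \<open>tri_m\<close> amounts to \<open>a\<close> and
  \<open>m j\<close> being non-proportional.\<close>

locale line_points =
  fixes a :: "complex ^ 3" and J :: "'j set" and m v :: "'j \<Rightarrow> complex ^ 3"
  assumes finite_J: "finite J"
    and tri_m: "j \<in> J \<Longrightarrow> \<exists>c. tri a (m j) c"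
    and v_nonzero: "j \<in> J \<Longrightarrow> v j \<noteq> 0"
    and a_v: "j \<in> J \<Longrightarrow> dot a (v j) = 0"
    and m_v: "j \<in> J \<Longrightarrow> dot (m j) (v j) = 0"
    and m_v_neq: "i \<in> J \<Longrightarrow> j \<in> J \<Longrightarrow> i \<noteq> j \<Longrightarrow> dot (m i) (v j) \<noteq> 0"
begin

lemma prod_nonzero: "j \<in> J \<Longrightarrow> K \<subseteq> J \<Longrightarrow> j \<notin> K \<Longrightarrow> (\<Prod>i\<in>K. dot (m i) (v j)) \<noteq> 0"
  using finite_subset[OF _ finite_J, of K] m_v_neq by (auto simp: prod_zero_iff)

text \<open>Modulo \<open>lform a\<close> the form is binary, and each zero \<open>v j\<close>
  splits off a factor \<open>lform (m j)\<close>. Working with subsets of \<open>J\<close> keeps the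
  induction inside one instance of the locale.\<close>

lemma vanish_decomp_subset:
  assumes "K \<subseteq> J" "h \<in> hom k" "\<And>j. j \<in> K \<Longrightarrow> poly_eval h (v j) = 0"
  shows "\<exists>u w. h = lform a * u + (\<Prod>j\<in>K. lform (m j)) * w \<and> u \<in> hom (k - 1) \<and> w \<in> hom (k - int (card K))"
proof -
  have "finite K" using assms(1) finite_J finite_subset by blast
  then show ?thesis using assms(1,3)
  proof induction
    case empty
    show ?case using assms(2) by (intro exI[of _ 0] exI[of _ h]) simp
  next
    case (insert j K)
    then obtain u w where h: "h = lform a * u + (\<Prod>j\<in>K. lform (m j)) * w"
      and u: "u \<in> hom (k - 1)" and w: "w \<in> hom (k - int (card K))"
      by auto
    have j: "j \<in> J" using insert by simp
    have "(\<Prod>i\<in>K. dot (m i) (v j)) * poly_eval w (v j) = 0"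
      using insert.prems(2)[of j] j by (simp add: h poly_eval_simps a_v)
    then have "poly_eval w (v j) = 0" using prod_nonzero[of j K] j insert by auto
    moreover obtain c where "tri a (m j) c" using tri_m j by blast
    ultimately obtain u' w' where w': "w = lform a * u' + lform (m j) * w'"
      "u' \<in> hom (k - int (card K) - 1)" "w' \<in> hom (k - int (card K) - 1)"
      using hom_vanish_point v_nonzero a_v m_v j w by metis
    have "h = lform a * (u + (\<Prod>j\<in>K. lform (m j)) * u') + (\<Prod>j\<in>insert j K. lform (m j)) * w'"
      using insert by (simp add: h w'(1) algebra_simps)
    moreover have "u + (\<Prod>j\<in>K. lform (m j)) * u' \<in> hom (k - 1)"
      by (rule hom_add[OF u], rule hom_mult'[OF hom_prod_lform w'(2)]) (use insert in auto)
    moreover have "w' \<in> hom (k - int (card (insert j K)))"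
      using w'(3) insert by (simp add: algebra_simps)
    ultimately show ?case by blast
  qed
qed

lemmas vanish_decomp = vanish_decomp_subset[OF order_refl]

text \<open>Lagrange interpolation for binary forms, lifted from the line \<open>a\<close> to the plane.\<close>

lemma interpolation:
  assumes "J \<noteq> {}" "q \<in> hom k" "int (card J) \<le> k + 1"
  shows "\<exists>u w. q = lform a * u + (\<Sum>j\<in>J. (\<Prod>i\<in>J - {j}. lform (m i)) * w j)"
proof -
  have "\<exists>u w. q = lform a * u + (\<Sum>j\<in>K. (\<Prod>i\<in>K - {j}. lform (m i)) * w j)"
    if "finite K" "K \<noteq> {}" "K \<subseteq> J" "q \<in> hom k" "int (card K) \<le> k + 1" for K q k
    using that
  proof (induction K arbitrary: q k rule: finite_ne_induct)
    case (singleton j)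
    show ?case by (intro exI[of _ 0] exI[of _ "\<lambda>_. q"]) simp
  next
    case (insert j K)
    let ?G = "\<Prod>i\<in>K. lform (m i)"
    have j: "j \<in> J" using insert by simp
    have G0: "poly_eval ?G (v j) \<noteq> 0"
      using prod_nonzero[of j K] insert j by (simp add: poly_eval_simps)
    have "0 \<le> k - int (card K)" using insert by simp
    \<comment> \<open>The multiple \<open>?G * s\<close> corrects the value at \<open>v j\<close>
      only; what remains is divisible by \<open>lform (m j)\<close> modulo \<open>lform a\<close>,
      so degree and number of points both drop by one.\<close>
    then obtain s where s: "s \<in> hom (k - int (card K))"
      "poly_eval s (v j) = poly_eval q (v j) / poly_eval ?G (v j)"
      using hom_value v_nonzero[OF j] by blast
    have "?G * s \<in> hom k" by (rule hom_mult'[OF hom_prod_lform s(1)]) (use insert in auto)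
    then have "q - ?G * s \<in> hom k" using insert by (intro hom_diff)
    moreover have "poly_eval (q - ?G * s) (v j) = 0"
      unfolding poly_eval_diff poly_eval_mult s(2) using G0 by simp
    moreover obtain c where "tri a (m j) c" using tri_m j by blast
    ultimately obtain u r where r: "q - ?G * s = lform a * u + lform (m j) * r" "r \<in> hom (k - 1)"
      using hom_vanish_point v_nonzero a_v m_v j by metis
    have "int (card K) \<le> k - 1 + 1" using insert by simp
    then obtain u' w where w: "r = lform a * u' + (\<Sum>j\<in>K. (\<Prod>i\<in>K - {j}. lform (m i)) * w j)"
      using insert.IH[of r "k - 1"] insert.prems r by auto
    define w' where "w' = w(j := s)"
    have "(\<Sum>i\<in>K. (\<Prod>i\<in>insert j K - {i}. lform (m i)) * w' i) =
      lform (m j) * (\<Sum>i\<in>K. (\<Prod>i\<in>K - {i}. lform (m i)) * w i)"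
      unfolding sum_distrib_left
    proof (rule sum.cong)
      fix i assume i: "i \<in> K"
      then have "insert j K - {i} = insert j (K - {i})" using insert by auto
      then show "(\<Prod>i\<in>insert j K - {i}. lform (m i)) * w' i =
        lform (m j) * ((\<Prod>i\<in>K - {i}. lform (m i)) * w i)"
        using insert i by (auto simp: w'_def algebra_simps)
    qed simp
    moreover have "insert j K - {j} = K" using insert by auto
    ultimately have "(\<Sum>i\<in>insert j K. (\<Prod>i\<in>insert j K - {i}. lform (m i)) * w' i) =
      ?G * s + lform (m j) * (\<Sum>i\<in>K. (\<Prod>i\<in>K - {i}. lform (m i)) * w i)"
      using insert by (simp add: w'_def)
    moreover have "q = lform a * (u + lform (m j) * u') + (?G * s
        + lform (m j) * (\<Sum>i\<in>K. (\<Prod>i\<in>K - {i}. lform (m i)) * w i))"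
      using r(1) by (simp add: w algebra_simps)
    ultimately show ?case
      by (intro exI[of _ "u + lform (m j) * u'"] exI[of _ w']) simp
  qed
  then show ?thesis using assms finite_J by blast
qed

end

section \<open>Parametrized lines\<close>

text \<open>\<open>v\<close> and \<open>w\<close> span the plane in \<open>\<complex>\<^sup>3\<close> lying over the line \<open>a\<close>.\<close>

definition line_basis :: "complex ^ 3 \<Rightarrow> complex ^ 3 \<Rightarrow> complex ^ 3 \<Rightarrow> bool" where
  "line_basis a v w \<longleftrightarrow> (\<exists>b c. tri a b c \<and> dot a v = 0 \<and> dot b v = 1 \<and> dot c v = 0
     \<and> dot a w = 0 \<and> dot b w = 0 \<and> dot c w = 1)"

lemma line_basis_exists: assumes "a \<noteq> 0" obtains v w where "line_basis a v w"
proof -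
  obtain b c where t: "tri a b c" using tri_exists assms by blast
  obtain v where "dot b v = 1" "dot c v = 0" "dot a v = 0" using tri_dual[OF tri_rotate[OF t]] .
  moreover obtain w where "dot c w = 1" "dot a w = 0" "dot b w = 0"
    using tri_dual[OF tri_rotate[OF tri_rotate[OF t]]] .
  ultimately show ?thesis using that t unfolding line_basis_def by blast
qed

lemma line_basis_dot: "line_basis a v w \<Longrightarrow> dot a (v + t *s w) = 0"
  by (auto simp: line_basis_def dot_add dot_scale)

lemma line_basis_nonzero:
  assumes "line_basis a v w" shows "v + t *s w \<noteq> 0" "w \<noteq> 0"
proof -
  obtain b c where b: "dot b v = 1" "dot b w = 0" and c: "dot c w = 1"
    using assms unfolding line_basis_def by blast
  have "dot b (v + t *s w) \<noteq> 0" using b by (simp add: dot_add dot_scale)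
  then show "v + t *s w \<noteq> 0" by (metis dot_0)
  show "w \<noteq> 0" using c by (metis dot_0 zero_neq_one)
qed

lemma line_basis_span:
  assumes "line_basis a v w" "dot a x = 0"
  obtains \<alpha> \<beta> where "x = \<alpha> *s v + \<beta> *s w"
proof -
  obtain b c where t: "tri a b c" "dot a v = 0 \<and> dot b v = 1 \<and> dot c v = 0
     \<and> dot a w = 0 \<and> dot b w = 0 \<and> dot c w = 1"
    using assms unfolding line_basis_def by blast
  have "x = dot b x *s v + dot c x *s w"
    by (rule tri_eqI[OF t(1)]) (use t(2) assms(2) in \<open>auto simp: dot_add dot_scale\<close>)
  then show ?thesis by (rule that)
qed

text \<open>Any \<open>k + 1\<close> of the zeros on the line are enough.\<close>

lemma lform_dvd_of_infinite:
  assumes basis: "line_basis a v w" and h: "h \<in> hom k"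
    and inf: "infinite {t. poly_eval h (v + t *s w) = 0}"
  obtains u where "h = lform a * u" "u \<in> hom (k - 1)"
proof (cases "k < 0")
  case True
  then have "h = 0" using hom_negD h by blast
  then show ?thesis using that[of 0] by simp
next
  case False
  obtain T where T: "T \<subseteq> {t. poly_eval h (v + t *s w) = 0}" "finite T" "card T = nat k + 1"
    using infinite_arbitrarily_large[OF inf] by blast
  obtain b c where t: "tri a b c" "dot a v = 0" "dot b v = 1" "dot c v = 0"
     "dot a w = 0" "dot b w = 0" "dot c w = 1"
    using basis unfolding line_basis_def by blast
  \<comment> \<open>The form \<open>t *s b - c\<close> takes the value \<open>t - s\<close> at the
    point with parameter \<open>s\<close>, so it singles out the parameter \<open>t\<close> on the
    line.\<close>
  interpret line_points a T "\<lambda>t. t *s b - c" "\<lambda>t. v + t *s w"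
  proof
    fix s
    have "tri a (s *s b - c) b"
      using t(1) by (auto simp: tri_def dot_diff_left dot_scale_left)
    then show "\<exists>d. tri a (s *s b - c) d" by blast
  qed (use t T(2) line_basis_nonzero(1)[OF basis] in \<open>auto simp: dot_diff_left dot_scale_left dot_add dot_scale\<close>)
  obtain u r where "h = lform a * u + (\<Prod>j\<in>T. lform (j *s b - c)) * r"
    "u \<in> hom (k - 1)" "r \<in> hom (k - int (card T))"
    using vanish_decomp[OF h] T by blast
  \<comment> \<open>With \<open>nat k + 1\<close> zeros the cofactor \<open>r\<close> has degree
    -1.\<close>
  moreover have "r = 0" using calculation(3) hom_negD T False by auto
  ultimately show ?thesis using that by (metis add.right_neutral mult_zero_right)
qed

section \<open>Generic arrangements\<close>

text \<open>Infinitely many zeros would make \<open>lform a\<close> divide \<open>lform e\<close>,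
  which fails at a point where \<open>a\<close> vanishes and \<open>e\<close> does not.\<close>

lemma finite_zeros_on_line:
  assumes "line_basis a v w" "tri a e c"
  shows "finite {t. dot e (v + t *s w) = 0}"
proof (rule ccontr)
  assume "infinite {t. dot e (v + t *s w) = 0}"
  then obtain u where u: "lform e = lform a * u"
    using lform_dvd_of_infinite[OF assms(1) hom_lform, of e] by auto
  obtain x where "dot e x = 1" "dot c x = 0" "dot a x = 0"
    using tri_dual[OF tri_rotate[OF assms(2)]] .
  then show False
    using arg_cong[OF u, of "\<lambda>p. poly_eval p x"] by (simp add: poly_eval_mult)
qed

locale arrangement =
  fixes I :: "'i set" and a :: "'i \<Rightarrow> complex ^ 3"
  assumes finite_I: "finite I" and card_I: "4 \<le> card I"
    and generic: "i \<in> I \<Longrightarrow> j \<in> I \<Longrightarrow> k \<in> I \<Longrightarrow> i \<noteq> j \<Longrightarrow> i \<noteq> k \<Longrightarrow> j \<noteq> k \<Longrightarrow> tri (a i) (a j) (a k)"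
begin

text \<open>The whole equation is \<open>L I\<close>; its quotients by one or two lines are
  \<open>L (I - {i})\<close> and \<open>L (I - {i, j})\<close>.\<close>

definition L :: "'i set \<Rightarrow> poly3" where
  "L K = (\<Prod>i\<in>K. lform (a i))"

text \<open>Indexing by sets makes the node of two lines independent of their order and lets the
  2-element subsets of \<open>I\<close> enumerate all nodes.\<close>

definition node :: "'i set \<Rightarrow> complex ^ 3" where
  "node A = (SOME v. v \<noteq> 0 \<and> (\<forall>i\<in>A. dot (a i) v = 0))"

lemma finite_sub: "K \<subseteq> I \<Longrightarrow> finite K"
  using finite_I finite_subset by blast

lemma L_remove: "K \<subseteq> I \<Longrightarrow> i \<in> K \<Longrightarrow> L K = lform (a i) * L (K - {i})"
  unfolding L_def by (rule prod.remove) (auto intro: finite_sub)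

lemma L_insert: "K \<subseteq> I \<Longrightarrow> i \<notin> K \<Longrightarrow> L (insert i K) = lform (a i) * L K"
  unfolding L_def by (simp add: finite_sub)

lemma L_hom: "K \<subseteq> I \<Longrightarrow> L K \<in> hom (int (card K))"
  unfolding L_def by (intro hom_prod_lform finite_sub)

text \<open>Genericity speaks of triples only; completing a pair to a triple gives the independence
  of two lines.\<close>

lemma third_line:
  assumes "i \<in> I" "j \<in> I" "i \<noteq> j"
  obtains k where "k \<in> I" "k \<noteq> i" "k \<noteq> j" "tri (a i) (a j) (a k)"
proof -
  have "\<not> I \<subseteq> {i, j}"
    using card_mono[of "{i, j}" I] card_I card_insert_le_m1[of 2 "{j}" i] by auto
  then show ?thesis using that generic assms by blast
qed

lemma pair_tri: "i \<in> I \<Longrightarrow> j \<in> I \<Longrightarrow> i \<noteq> j \<Longrightarrow> \<exists>c. tri (a i) (a j) c"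
  using third_line by metis

lemma node:
  assumes "i \<in> I" "j \<in> I" "i \<noteq> j"
  shows node_nonzero: "node {i, j} \<noteq> 0" and node_left: "dot (a i) (node {i, j}) = 0"
    and node_right: "dot (a j) (node {i, j}) = 0"
    and node_other: "k \<in> I \<Longrightarrow> k \<noteq> i \<Longrightarrow> k \<noteq> j \<Longrightarrow> dot (a k) (node {i, j}) \<noteq> 0"
proof -
  obtain m where "tri (a i) (a j) (a m)" using third_line assms by blast
  then obtain v where "dot (a m) v = 1" "dot (a i) v = 0" "dot (a j) v = 0"
    using tri_dual tri_rotate by metis
  then have "v \<noteq> 0 \<and> (\<forall>i\<in>{i, j}. dot (a i) v = 0)" by auto
  then have *: "node {i, j} \<noteq> 0 \<and> (\<forall>k\<in>{i, j}. dot (a k) (node {i, j}) = 0)"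
    unfolding node_def by (rule someI)
  then show "node {i, j} \<noteq> 0" "dot (a i) (node {i, j}) = 0" "dot (a j) (node {i, j}) = 0"
    by auto
  assume "k \<in> I" "k \<noteq> i" "k \<noteq> j"
  then have "tri (a i) (a j) (a k)" using generic assms by blast
  then show "dot (a k) (node {i, j}) \<noteq> 0" using * by (auto simp: tri_def)
qed

lemma line_points: "i \<in> I \<Longrightarrow> K \<subseteq> I - {i} \<Longrightarrow> line_points (a i) K a (\<lambda>j. node {i, j})"
  by unfold_locales (auto intro!: pair_tri simp: node_nonzero node_left node_right subset_iff
      intro: finite_sub dest: node_other[rotated -1])

lemma eval_L_eq_0_iff: "K \<subseteq> I \<Longrightarrow> poly_eval (L K) x = 0 \<longleftrightarrow> (\<exists>i\<in>K. dot (a i) x = 0)"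
  by (simp add: L_def poly_eval_prod prod_zero_iff finite_sub)

lemma L_nonzero: assumes "K \<subseteq> I" shows "L K \<noteq> 0"
proof -
  have "lform (a i) \<noteq> 0" if i: "i \<in> I" for i
  proof
    assume 0: "lform (a i) = 0"
    have "\<not> I \<subseteq> {i}" using card_mono[of "{i}" I] card_I by auto
    then obtain j where j: "j \<in> I" "j \<noteq> i" by blast
    then obtain c where "tri (a i) (a j) c" using pair_tri i by metis
    then obtain x where "dot (a i) x = 1" using tri_dual by metis
    then show False using 0 by (metis poly_eval_lform poly_eval_0 zero_neq_one)
  qed
  then show ?thesis using assms by (auto simp: L_def prod_zero_iff finite_sub)
qed

text \<open>Away from finitely many points of the line \<open>i\<close>, the factor \<open>L K\<close> is invertible.\<close>

lemma lform_dvd_cancel: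
  assumes i: "i \<in> I" and K: "K \<subseteq> I - {i}" and h: "h \<in> hom k"
    and zero: "\<And>x. dot (a i) x = 0 \<Longrightarrow> x \<noteq> 0 \<Longrightarrow> poly_eval (L K * h) x = 0"
  obtains u where "h = lform (a i) * u" "u \<in> hom (k - 1)"
proof -
  have "\<not> I \<subseteq> {i}" using card_mono[of "{i}" I] card_I by auto
  then obtain j where "j \<in> I" "j \<noteq> i" by blast
  then have "a i \<noteq> 0" using tri_dual pair_tri i by (metis dot_0_left zero_neq_one)
  then obtain v w where vw: "line_basis (a i) v w" using line_basis_exists by blast
  have "finite (\<Union>j\<in>K. {t. dot (a j) (v + t *s w) = 0})"
  proof (rule finite_UN_I)
    fix j assume "j \<in> K"
    then obtain c where "tri (a i) (a j) c" using K pair_tri[OF i, of j] by auto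
    then show "finite {t. dot (a j) (v + t *s w) = 0}" by (rule finite_zeros_on_line[OF vw])
  qed (use K in \<open>auto intro: finite_sub\<close>)
  moreover have "UNIV \<subseteq> (\<Union>j\<in>K. {t. dot (a j) (v + t *s w) = 0}) \<union> {t. poly_eval h (v + t *s w) = 0}"
  proof
    fix t
    have "poly_eval (L K * h) (v + t *s w) = 0"
      using line_basis_dot[OF vw] line_basis_nonzero(1)[OF vw] by (rule zero)
    then show "t \<in> (\<Union>j\<in>K. {t. dot (a j) (v + t *s w) = 0}) \<union> {t. poly_eval h (v + t *s w) = 0}"
      using K eval_L_eq_0_iff[of K] by (fastforce simp: poly_eval_mult)
  qed
  ultimately have "infinite {t. poly_eval h (v + t *s w) = 0}"
    using infinite_UNIV_char_0 by (metis finite_UnI finite_subset)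
  then show ?thesis using lform_dvd_of_infinite[OF vw h] that by blast
qed

text \<open>On the line \<open>i\<close> the form is divisible by the product of the other lines.
  The part left over is \<open>lform (a i)\<close> times a form \<open>u\<close> that vanishes at
  the remaining nodes, to which induction applies. In negative quotient degree the result forces
  \<open>h = 0\<close>.\<close>

lemma star_ideal:
  assumes "K \<subseteq> I" "K \<noteq> {}" "h \<in> hom k"
    and "\<And>i j. i \<in> K \<Longrightarrow> j \<in> K \<Longrightarrow> i \<noteq> j \<Longrightarrow> poly_eval h (node {i, j}) = 0"
  shows "\<exists>q. (\<forall>i\<in>K. q i \<in> hom (k - int (card K) + 1)) \<and> h = (\<Sum>i\<in>K. L (K - {i}) * q i)"
proof -
  have "finite K" using assms(1) by (rule finite_sub)
  from this assms(2,1,3,4) show ?thesis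
  proof (induction K arbitrary: h k rule: finite_ne_induct)
    case (singleton i)
    then show ?case by (intro exI[of _ "\<lambda>_. h"]) (simp add: L_def)
  next
    case (insert i K)
    have i: "i \<in> I" and K: "K \<subseteq> I - {i}" using insert by auto
    interpret line_points "a i" K a "\<lambda>j. node {i, j}" by (rule line_points[OF i K])
    have "\<And>j. j \<in> K \<Longrightarrow> poly_eval h (node {i, j}) = 0"
      using insert.prems(3) insert.hyps by auto
    then obtain u w where h: "h = lform (a i) * u + L K * w"
      and u: "u \<in> hom (k - 1)" and w: "w \<in> hom (k - int (card K))"
      using vanish_decomp[OF insert.prems(2)] by (auto simp: L_def)
    have "poly_eval u (node {m, n}) = 0" if mn: "m \<in> K" "n \<in> K" "m \<noteq> n" for m n
    proof -
      have "m \<in> I" "n \<in> I" "m \<noteq> i" "n \<noteq> i" using mn K by auto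
      \<comment> \<open>A node of two lines of \<open>K\<close> kills \<open>L K\<close> but lies
        off the line \<open>i\<close>, so the zero of \<open>h\<close> there is a zero of
        \<open>u\<close>.\<close>
      then have "poly_eval (L K) (node {m, n}) = 0" "dot (a i) (node {m, n}) \<noteq> 0"
        using mn K i node_left[of m n] node_other[of m n i] eval_L_eq_0_iff[of K] by blast+
      moreover have "poly_eval h (node {m, n}) = 0"
        using insert.prems(3) mn by blast
      ultimately show ?thesis by (simp add: h poly_eval_simps)
    qed
    then obtain q where q: "\<forall>i\<in>K. q i \<in> hom (k - 1 - int (card K) + 1)" "u = (\<Sum>i\<in>K. L (K - {i}) * q i)"
      using insert.IH[OF _ u] K by blast
    define q' where "q' = q(i := w)"
    have "(\<Sum>j\<in>K. L (insert i K - {j}) * q' j) = lform (a i) * (\<Sum>j\<in>K. L (K - {j}) * q j)"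
      unfolding sum_distrib_left
    proof (rule sum.cong)
      fix j assume j: "j \<in> K"
      then have "insert i K - {j} = insert i (K - {j})" using K by auto
      moreover have "L (insert i (K - {j})) = lform (a i) * L (K - {j})"
        using K by (intro L_insert) auto
      moreover have "q' j = q j" using K j by (auto simp: q'_def)
      ultimately show "L (insert i K - {j}) * q' j = lform (a i) * (L (K - {j}) * q j)"
        by simp
    qed simp
    moreover have "insert i K - {i} = K" using K by auto
    ultimately have "h = (\<Sum>j\<in>insert i K. L (insert i K - {j}) * q' j)"
      using insert.hyps by (simp add: h q(2) q'_def algebra_simps)
    moreover have "\<forall>j\<in>insert i K. q' j \<in> hom (k - int (card (insert i K)) + 1)"
      using q(1) w insert.hyps by (auto simp: q'_def)
    ultimately show ?case by blast
  qed
qed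

text \<open>This is the Leibniz rule for the derivation with coefficients \<open>s\<close>; the
  inner sum is its value on the linear form of the line \<open>i\<close>.\<close>

lemma sum_partial_deriv:
  fixes s :: "poly3 ^ 3"
  shows "(\<Sum>t\<in>UNIV. s $ t * partial_deriv t (L I)) =
    (\<Sum>i\<in>I. (\<Sum>t\<in>UNIV. s $ t * const_poly (a i $ t)) * L (I - {i}))"
  unfolding L_def partial_deriv_prod_lform[OF finite_I]
  by (simp add: sum_distrib_left sum_distrib_right algebra_simps) (rule sum.swap)

end

section \<open>The Jacobian ideal\<close>

lemma jacobian_idealI: "(\<Sum>i\<in>UNIV. s $ i * partial_deriv i f) \<in> jacobian_ideal f"
  unfolding jacobian_ideal_def by blast

lemma jacobian_ideal_0 [simp]: "0 \<in> jacobian_ideal f"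
  using jacobian_idealI[of 0 f] by simp

lemma jacobian_ideal_add:
  assumes "p \<in> jacobian_ideal f" "q \<in> jacobian_ideal f" shows "p + q \<in> jacobian_ideal f"
proof -
  obtain s s' where "p = (\<Sum>i\<in>UNIV. s $ i * partial_deriv i f)" "q = (\<Sum>i\<in>UNIV. s' $ i * partial_deriv i f)"
    using assms unfolding jacobian_ideal_def by blast
  then have "p + q = (\<Sum>i\<in>UNIV. (s + s') $ i * partial_deriv i f)"
    by (simp add: algebra_simps sum.distrib)
  then show ?thesis by (simp only: jacobian_idealI)
qed

lemma jacobian_ideal_mult:
  assumes "p \<in> jacobian_ideal f" shows "r * p \<in> jacobian_ideal f"
proof -
  obtain s where "p = (\<Sum>i\<in>UNIV. s $ i * partial_deriv i f)"
    using assms unfolding jacobian_ideal_def by blast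
  then have "r * p = (\<Sum>i\<in>UNIV. (\<chi> i. r * s $ i) $ i * partial_deriv i f)"
    by (simp add: algebra_simps sum_distrib_left)
  then show ?thesis by (simp only: jacobian_idealI)
qed

lemma jacobian_ideal_diff:
  "p \<in> jacobian_ideal f \<Longrightarrow> q \<in> jacobian_ideal f \<Longrightarrow> p - q \<in> jacobian_ideal f"
  using jacobian_ideal_add[OF _ jacobian_ideal_mult, of p f q "- 1"] by simp

lemma jacobian_ideal_sum:
  "(\<And>x. x \<in> A \<Longrightarrow> p x \<in> jacobian_ideal f) \<Longrightarrow> sum p A \<in> jacobian_ideal f"
  by (induction A rule: infinite_finite_induct) (auto intro: jacobian_ideal_add)

context arrangement
begin

lemma sum_const_mult: "(\<Sum>t\<in>UNIV. const_poly (v $ t) * const_poly (a i $ t)) = const_poly (dot (a i) v)"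
  by (simp add: dot_def const_poly_sum mult.commute flip: const_poly_mult)

lemma sum_var_mult: "(\<Sum>t\<in>UNIV. var t * const_poly (a i $ t)) = lform (a i)"
  by (simp add: lform_eq_sum mult.commute)

text \<open>The Euler field maps each linear form to itself, so each of the \<open>card I\<close>
  Leibniz terms equals \<open>L I\<close>.\<close>

lemma euler: "(\<Sum>t\<in>UNIV. var t * partial_deriv t (L I)) = of_nat (card I) * L I"
  using sum_partial_deriv[of "\<chi> t. var t"] by (simp add: sum_var_mult flip: L_remove)

lemma L_I_in_J: "L I \<in> jacobian_ideal (L I)"
proof -
  have "of_nat (card I) * L I \<in> jacobian_ideal (L I)"
    using jacobian_idealI[of "\<chi> t. var t" "L I"] by (simp add: euler)
  then have "const_poly (1 / of_nat (card I)) * (of_nat (card I) * L I) \<in> jacobian_ideal (L I)"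
    by (rule jacobian_ideal_mult)
  moreover have "const_poly (1 / of_nat (card I)) * of_nat (card I) = 1"
    using card_I by (auto simp flip: const_poly_of_nat const_poly_mult)
  ultimately show ?thesis by (simp flip: mult.assoc)
qed

text \<open>The factor \<open>lform (a m)\<close> moves from the first product to the second, which
  turns mixed products into multiples of \<open>L I\<close>.\<close>

lemma L_mult_swap:
  assumes "m \<in> I" "m \<notin> A"
  shows "L (I - A) * L (I - {m}) = L I * L (I - A - {m})"
  using L_remove[of "I - A" m] L_remove[of I m] assms by (simp add: algebra_simps)

lemma L_mult_in_J:
  assumes i: "i \<in> I" and j: "j \<in> I" and "i \<noteq> j"
  shows "L (I - {i, j}) * L (I - {i}) \<in> jacobian_ideal (L I)"
proof -
  obtain c where "tri (a i) (a j) c" using pair_tri assms by blast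
  \<comment> \<open>In this direction the derivative of \<open>L I\<close> contains
    \<open>L (I - {i})\<close> with coefficient 1 and no term for \<open>j\<close>; after
    multiplication by \<open>L (I - {i, j})\<close> all other terms are multiples of
    \<open>L I\<close>.\<close>
  then obtain v where v: "dot (a i) v = 1" "dot (a j) v = 0" using tri_dual by metis
  have "(\<Sum>m\<in>I. const_poly (dot (a m) v) * L (I - {m})) \<in> jacobian_ideal (L I)"
    using jacobian_idealI[of "\<chi> t. const_poly (v $ t)" "L I"]
    using sum_partial_deriv[of "\<chi> t. const_poly (v $ t)"] by (simp add: sum_const_mult)
  then have "L (I - {i, j}) * (\<Sum>m\<in>I. const_poly (dot (a m) v) * L (I - {m})) \<in> jacobian_ideal (L I)"
    by (rule jacobian_ideal_mult)
  also have "L (I - {i, j}) * (\<Sum>m\<in>I. const_poly (dot (a m) v) * L (I - {m})) =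
    L (I - {i, j}) * L (I - {i})
      + (\<Sum>m\<in>I - {i}. const_poly (dot (a m) v) * (L (I - {i, j}) * L (I - {m})))"
    using v i finite_I by (simp add: sum.remove[of I i] algebra_simps sum_distrib_left)
  finally have "L (I - {i, j}) * L (I - {i}) +
    (\<Sum>m\<in>I - {i}. const_poly (dot (a m) v) * (L (I - {i, j}) * L (I - {m}))) \<in> jacobian_ideal (L I)" .
  moreover have "(\<Sum>m\<in>I - {i}. const_poly (dot (a m) v) * (L (I - {i, j}) * L (I - {m})))
    \<in> jacobian_ideal (L I)"
  proof (rule jacobian_ideal_sum)
    fix m assume m: "m \<in> I - {i}"
    show "const_poly (dot (a m) v) * (L (I - {i, j}) * L (I - {m})) \<in> jacobian_ideal (L I)"
    proof (cases "m = j")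
      case False
      then have "L (I - {i, j}) * L (I - {m}) = L (I - {i, j} - {m}) * L I"
        using m L_mult_swap[of m "{i, j}"] by (simp add: mult.commute)
      then show ?thesis using L_I_in_J jacobian_ideal_mult by simp
    qed (simp add: v)
  qed
  ultimately show ?thesis
    using jacobian_ideal_diff by (metis (no_types, lifting) add_diff_cancel_right')
qed

text \<open>The line \<open>i\<close> carries \<open>card I - 1\<close> nodes, so
  \<open>card I - 2\<close> is the first degree in which interpolation at all of them reaches every
  form. The part divisible by \<open>lform (a i)\<close> contributes a multiple of
  \<open>L I\<close>.\<close>

lemma L_mult_form_in_J:
  assumes i: "i \<in> I" and q: "q \<in> hom k" "int (card I) - 2 \<le> k"
  shows "L (I - {i}) * q \<in> jacobian_ideal (L I)"
proof -
  interpret line_points "a i" "I - {i}" a "\<lambda>j. node {i, j}" by (rule line_points[OF i]) simp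
  have c: "card (I - {i}) = card I - 1" using i finite_I by simp
  then have "I - {i} \<noteq> {}" "int (card (I - {i})) \<le> k + 1" using card_I q by (force, simp)
  from interpolation[OF this(1) q(1) this(2)] obtain u w where
    w: "q = lform (a i) * u + (\<Sum>j\<in>I - {i}. L (I - {i} - {j}) * w j)"
    unfolding L_def by blast
  have "L (I - {i}) * q = u * (lform (a i) * L (I - {i}))
      + (\<Sum>j\<in>I - {i}. w j * (L (I - {i} - {j}) * L (I - {i})))"
    unfolding w by (simp add: algebra_simps sum_distrib_left)
  also have "lform (a i) * L (I - {i}) = L I"
    using L_remove[OF order_refl i] by simp
  finally have "L (I - {i}) * q = u * L I
      + (\<Sum>j\<in>I - {i}. w j * (L (I - {i} - {j}) * L (I - {i})))" .
  moreover have "w j * (L (I - {i} - {j}) * L (I - {i})) \<in> jacobian_ideal (L I)" if "j \<in> I - {i}" for j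
  proof -
    have "I - {i} - {j} = I - {i, j}" by blast
    then show ?thesis using L_mult_in_J[OF i, of j] that by (auto intro: jacobian_ideal_mult)
  qed
  ultimately show ?thesis
    by (metis (no_types, lifting) jacobian_ideal_add jacobian_ideal_mult jacobian_ideal_sum L_I_in_J)
qed

text \<open>The coefficients supplied by \<open>star_ideal\<close> have degree
  \<open>k - card I + 1\<close>, and the bound on \<open>k\<close> is what makes this at least
  \<open>card I - 2\<close>.\<close>

lemma jacobian_ideal_iff:
  assumes h: "h \<in> hom k" and k: "2 * int (card I) - 3 \<le> k"
  shows "h \<in> jacobian_ideal (L I) \<longleftrightarrow> (\<forall>i\<in>I. \<forall>j\<in>I. i \<noteq> j \<longrightarrow> poly_eval h (node {i, j}) = 0)"
proof
  assume "h \<in> jacobian_ideal (L I)"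
  then obtain s where s: "h = (\<Sum>t\<in>UNIV. s $ t * partial_deriv t (L I))"
    unfolding jacobian_ideal_def by blast
  have "poly_eval (L (I - {m})) (node {i, j}) = 0" if "i \<in> I" "j \<in> I" "i \<noteq> j" for i j m
    using that eval_L_eq_0_iff[of "I - {m}"] node_left[OF that] node_right[OF that]
    by (metis Diff_subset Diff_iff singletonD)
  then show "\<forall>i\<in>I. \<forall>j\<in>I. i \<noteq> j \<longrightarrow> poly_eval h (node {i, j}) = 0"
    by (simp add: s sum_partial_deriv poly_eval_sum poly_eval_mult)
next
  assume "\<forall>i\<in>I. \<forall>j\<in>I. i \<noteq> j \<longrightarrow> poly_eval h (node {i, j}) = 0"
  moreover have "I \<noteq> {}" using card_I by auto
  ultimately obtain q where "\<forall>i\<in>I. q i \<in> hom (k - int (card I) + 1)" "h = (\<Sum>i\<in>I. L (I - {i}) * q i)"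
    using star_ideal[OF order_refl _ h] by blast
  then show "h \<in> jacobian_ideal (L I)"
    using k by (auto intro!: jacobian_ideal_sum L_mult_form_in_J)
qed

end

section \<open>The global Tjurina number\<close>

lemma basis_modulo_unique:
  assumes "basis_modulo W V B" "v \<in> V"
    and "\<And>b. b \<notin> B \<Longrightarrow> c b = 0" "v - (\<Sum>b\<in>B. const_poly (c b) * b) \<in> W"
    and "\<And>b. b \<notin> B \<Longrightarrow> c' b = 0" "v - (\<Sum>b\<in>B. const_poly (c' b) * b) \<in> W"
  shows "c = c'"
  using assms unfolding basis_modulo_def by (metis (mono_tags, lifting))

lemma sum_fun_apply: "(\<Sum>x\<in>A. f x) y = (\<Sum>x\<in>A. f x y)" for f :: "'a \<Rightarrow> 'b \<Rightarrow> 'c::comm_monoid_add"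
  by (induction A rule: infinite_finite_induct) auto

text \<open>Evaluation at the points \<open>p x\<close> identifies \<open>hom k\<close> modulo \<open>W\<close> with the functions on \<open>N\<close>.\<close>

lemma card_basis_modulo:
  fixes p :: "'n \<Rightarrow> complex ^ 3" and b :: "'n \<Rightarrow> poly3"
  assumes N: "finite N"
    and W: "\<And>v. v \<in> hom k \<Longrightarrow> v \<in> W \<longleftrightarrow> (\<forall>x\<in>N. poly_eval v (p x) = 0)"
    and b: "\<And>x. x \<in> N \<Longrightarrow> b x \<in> hom k"
    and dual: "\<And>x y. x \<in> N \<Longrightarrow> y \<in> N \<Longrightarrow> poly_eval (b x) (p y) = (if x = y then 1 else 0)"
  shows "\<exists>B. basis_modulo W (hom k) B \<and> card B = card N"
    and "basis_modulo W (hom k) B \<Longrightarrow> card B = card N"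
proof -
  have comb: "v - (\<Sum>x\<in>A. const_poly (c x) * x) \<in> hom k" if "v \<in> hom k" "A \<subseteq> hom k" for v A c
    using that by (intro hom_diff hom_sum hom_const_mult) auto
  have inj_b: "inj_on b N"
    by (rule inj_onI) (metis dual zero_neq_one)
  show "\<exists>B. basis_modulo W (hom k) B \<and> card B = card N"
  proof (intro exI conjI)
    show "card (b ` N) = card N" by (rule card_image[OF inj_b])
    have sum: "poly_eval (\<Sum>x\<in>b ` N. const_poly (c x) * x) (p y) = c (b y)" if "y \<in> N" for c y
      using that N dual
      by (simp add: sum.reindex[OF inj_b] poly_eval_sum poly_eval_mult if_distrib[of "\<lambda>x. _ * x"] cong: if_cong)
    have sub: "b ` N \<subseteq> hom k" using b by auto
    have iff: "v - (\<Sum>x\<in>b ` N. const_poly (c x) * x) \<in> W \<longleftrightarrow> (\<forall>y\<in>N. c (b y) = poly_eval v (p y))"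
      if "v \<in> hom k" for v c
      using W[OF comb[OF that sub]] by (auto simp: poly_eval_diff sum)
    show "basis_modulo W (hom k) (b ` N)"
      unfolding basis_modulo_def
    proof (intro conjI ballI ex1I allI impI)
      fix v assume v: "v \<in> hom k"
      \<comment> \<open>For the dual family the coefficient of \<open>b x\<close> is the value at
        \<open>p x\<close>.\<close>
      let ?c = "\<lambda>x. if x \<in> b ` N then poly_eval v (p (the_inv_into N b x)) else 0"
      show "v - (\<Sum>x\<in>b ` N. const_poly (?c x) * x) \<in> W"
        unfolding iff[OF v] by (simp add: the_inv_into_f_f[OF inj_b])
      fix c assume c: "(\<forall>x. x \<notin> b ` N \<longrightarrow> c x = 0) \<and> v - (\<Sum>x\<in>b ` N. const_poly (c x) * x) \<in> W"
      show "c = ?c"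
      proof
        fix x
        show "c x = ?c x"
          using c iff[OF v] by (auto simp: the_inv_into_f_f[OF inj_b])
      qed
    qed (use N sub in auto)
  qed
  \<comment> \<open>For an arbitrary basis the value functions of its elements and the indicator
    functions of \<open>N\<close> are both independent and span each other, so the exchange lemma
    equates their numbers.\<close>
  assume B: "basis_modulo W (hom k) B"
  then have finB: "finite B" and subB: "B \<subseteq> hom k" by (auto simp: basis_modulo_def)
  interpret vs: vector_space "\<lambda>c (f :: 'n \<Rightarrow> complex) x. c * f x"
    by unfold_locales (auto simp: algebra_simps fun_eq_iff)
  define \<phi> where "\<phi> v = (\<lambda>x. if x \<in> N then poly_eval v (p x) else 0)" for v
  have \<phi>_W: "\<phi> v = \<phi> w \<longleftrightarrow> v - w \<in> W" if "v \<in> hom k" "w \<in> hom k" for v w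
    using W[OF hom_diff[OF that]] by (auto simp: \<phi>_def fun_eq_iff poly_eval_diff)
  have \<phi>_sum: "\<phi> (\<Sum>x\<in>A. const_poly (c x) * x) = (\<Sum>x\<in>A. (\<lambda>y. c x * \<phi> x y))" for A c
    by (simp add: \<phi>_def fun_eq_iff sum_fun_apply poly_eval_sum poly_eval_mult)
  have comb0: "(\<Sum>x\<in>B. const_poly (c x) * x) \<in> hom k" for c
    using subB by (intro hom_sum hom_const_mult) auto
  have uniq: "c = c'" if "\<And>x. x \<notin> B \<Longrightarrow> c x = 0" "\<And>x. x \<notin> B \<Longrightarrow> c' x = 0"
    "\<phi> (\<Sum>x\<in>B. const_poly (c x) * x) = \<phi> (\<Sum>x\<in>B. const_poly (c' x) * x)" for c c'
  proof (rule basis_modulo_unique[OF B comb0[of c]])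
    show "(\<Sum>x\<in>B. const_poly (c x) * x) - (\<Sum>x\<in>B. const_poly (c x) * x) \<in> W"
      using \<phi>_W[OF comb0 comb0] by blast
    show "(\<Sum>x\<in>B. const_poly (c x) * x) - (\<Sum>x\<in>B. const_poly (c' x) * x) \<in> W"
      using \<phi>_W[OF comb0 comb0] that(3) by blast
  qed (use that in auto)
  have single: "(\<Sum>x\<in>B. const_poly (if x = y then 1 else 0) * x) = y" if "y \<in> B" for y
    using that finB by (simp add: if_distrib[of const_poly] if_distrib[of "\<lambda>x. x * _"] cong: if_cong)
  have inj: "inj_on \<phi> B"
  proof (rule inj_onI)
    fix y z assume yz: "y \<in> B" "z \<in> B" "\<phi> y = \<phi> z"
    \<comment> \<open>Two basis elements with equal values give two coefficient functions for one
      residue class, which uniqueness identifies.\<close>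
    have "(\<lambda>x. if x = y then 1 else 0 :: complex) = (\<lambda>x. if x = z then 1 else 0)"
      by (rule uniq) (use yz single in auto)
    then show "y = z" by (metis zero_neq_one)
  qed
  define \<delta> where "\<delta> x = (\<lambda>y. if y = x then 1 else 0 :: complex)" for x :: 'n
  have inj_\<delta>: "inj_on \<delta> N" by (rule inj_onI) (metis \<delta>_def zero_neq_one)
  have \<delta>_sum: "(\<Sum>x\<in>N. (\<lambda>y. g x * \<delta> x y)) = (\<lambda>y. if y \<in> N then g y else 0)" for g
    using N by (auto simp: fun_eq_iff \<delta>_def sum_fun_apply if_distrib[of "\<lambda>x. _ * x"] cong: if_cong)
  have indep_\<phi>: "vs.independent (\<phi> ` B)"
  proof (rule vs.independent_if_scalars_zero)
    fix f z assume f: "(\<Sum>x\<in>\<phi> ` B. (\<lambda>y. f x * x y)) = 0" and z: "z \<in> \<phi> ` B"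
    \<comment> \<open>A relation between the value functions and the zero relation represent the
      same class; cutting off outside \<open>B\<close> makes the uniqueness clause
      applicable.\<close>
    have "\<phi> (\<Sum>x\<in>B. const_poly (if x \<in> B then f (\<phi> x) else 0) * x) = (\<Sum>x\<in>B. (\<lambda>y. f (\<phi> x) * \<phi> x y))"
      unfolding \<phi>_sum by (rule sum.cong) auto
    also have "\<dots> = \<phi> (\<Sum>x\<in>B. const_poly 0 * x)"
      using f sum.reindex[OF inj, of "\<lambda>x y. f x * x y"] by (simp add: o_def) (simp add: \<phi>_def fun_eq_iff)
    finally have "(\<lambda>x. if x \<in> B then f (\<phi> x) else 0) = (\<lambda>_. 0)"
      by (intro uniq) auto
    then show "f z = 0" using z by (auto simp: fun_eq_iff split: if_splits)
  qed (use finB in simp)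
  have indep_\<delta>: "vs.independent (\<delta> ` N)"
  proof (rule vs.independent_if_scalars_zero)
    fix f z assume f: "(\<Sum>x\<in>\<delta> ` N. (\<lambda>y. f x * x y)) = 0" and z: "z \<in> \<delta> ` N"
    then have "(\<lambda>y. if y \<in> N then f (\<delta> y) else 0) = 0"
      using \<delta>_sum[of "\<lambda>x. f (\<delta> x)"] by (simp add: sum.reindex[OF inj_\<delta>])
    then show "f z = 0" using z by (auto simp: fun_eq_iff split: if_splits)
  qed (use N in simp)
  have "\<phi> ` B \<subseteq> vs.span (\<delta> ` N)"
  proof
    fix z assume "z \<in> \<phi> ` B"
    then obtain v where "z = \<phi> v" by blast
    then have "z = (\<Sum>x\<in>N. (\<lambda>y. poly_eval v (p x) * \<delta> x y))"
      by (simp add: \<delta>_sum \<phi>_def)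
    then show "z \<in> vs.span (\<delta> ` N)"
      by (auto intro: vs.span_sum vs.span_scale vs.span_base)
  qed
  moreover have "\<delta> ` N \<subseteq> vs.span (\<phi> ` B)"
  proof
    fix z assume "z \<in> \<delta> ` N"
    then obtain x where x: "x \<in> N" "z = \<delta> x" by blast
    then obtain c where c: "b x - (\<Sum>y\<in>B. const_poly (c y) * y) \<in> W"
      using B b unfolding basis_modulo_def by blast
    have "\<delta> x = \<phi> (b x)" using x dual by (auto simp: \<delta>_def \<phi>_def fun_eq_iff)
    also have "\<dots> = \<phi> (\<Sum>y\<in>B. const_poly (c y) * y)"
      using \<phi>_W[OF b[OF x(1)] comb0] c by blast
    finally show "z \<in> vs.span (\<phi> ` B)"
      unfolding x(2) \<phi>_sum
      by (auto intro: vs.span_sum vs.span_scale vs.span_base)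
  qed
  ultimately have "card (\<phi> ` B) = card (\<delta> ` N)"
    using vs.independent_span_bound[of "\<delta> ` N" "\<phi> ` B"] vs.independent_span_bound[of "\<phi> ` B" "\<delta> ` N"]
      indep_\<phi> indep_\<delta> N finB by (simp add: le_antisym)
  then show "card B = card N" by (simp add: card_image inj inj_\<delta>)
qed

context arrangement
begin

text \<open>The product of the lines missing a node vanishes at every other node, since another node
  lies on one of those lines. Suitable multiples of these products are dual to evaluation at the
  nodes.\<close>

lemma hilbert_function_eq:
  assumes "2 * card I - 3 \<le> k"
  shows "hilbert_function (jacobian_ideal (L I)) k = card I choose 2"
proof -
  define N where "N = {A. A \<subseteq> I \<and> card A = 2}"
  have N: "finite N" "card N = card I choose 2"
    using finite_I n_subsets[OF finite_I] by (auto simp: N_def)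
  have N_pair: "\<exists>i j. A = {i, j} \<and> i \<in> I \<and> j \<in> I \<and> i \<noteq> j" if "A \<in> N" for A
    using that by (force simp: N_def card_2_iff)
  have pair_N: "{i, j} \<in> N" if "i \<in> I" "j \<in> I" "i \<noteq> j" for i j
    using that by (auto simp: N_def)
  have W: "v \<in> jacobian_ideal (L I) \<longleftrightarrow> (\<forall>A\<in>N. poly_eval v (node A) = 0)" if "v \<in> hom (int k)" for v
    using jacobian_ideal_iff[OF that] assms N_pair pair_N by fastforce
  have "\<exists>b\<in>hom (int k). \<forall>A'\<in>N. poly_eval b (node A') = (if A = A' then 1 else 0)"
    if A: "A \<in> N" for A
  proof -
    obtain i j where ij: "A = {i, j}" "i \<in> I" "j \<in> I" "i \<noteq> j" using N_pair A by blast
    have c: "card (I - A) = card I - 2" using ij finite_I by (simp add: card_Diff_subset)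
    have "0 \<le> int k - int (card (I - A))" using c assms card_I by auto
    \<comment> \<open>The factor \<open>s\<close> raises the degree from \<open>card I - 2\<close>
      to \<open>k\<close> and normalises the value at the node.\<close>
    then obtain s where s: "s \<in> hom (int k - int (card (I - A)))"
      "poly_eval s (node A) = 1 / poly_eval (L (I - A)) (node A)"
      using hom_value node_nonzero[OF ij(2-)] ij(1) by metis
    have "L (I - A) * s \<in> hom (int k)" by (rule hom_mult'[OF L_hom s(1)]) auto
    moreover have "poly_eval (L (I - A) * s) (node A') = (if A = A' then 1 else 0)" if A': "A' \<in> N" for A'
    proof (cases "A = A'")
      case True
      have "poly_eval (L (I - A)) (node A) \<noteq> 0"
        using ij node_other[OF ij(2-)] by (subst eval_L_eq_0_iff) auto
      then show ?thesis using True s(2) by (simp add: poly_eval_mult)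
    next
      case False
      have "\<not> A' \<subseteq> A"
        using False A A' card_subset_eq[of A A'] finite_sub[of A] by (auto simp: N_def)
      then obtain m where m: "m \<in> A'" "m \<notin> A" by blast
      obtain i' j' where ij': "A' = {i', j'}" "i' \<in> I" "j' \<in> I" "i' \<noteq> j'" using N_pair A' by blast
      have "dot (a m) (node A') = 0" using m ij' node_left[OF ij'(2-)] node_right[OF ij'(2-)] by auto
      then have "poly_eval (L (I - A)) (node A') = 0"
        using m ij' by (subst eval_L_eq_0_iff) auto
      then show ?thesis using False by (simp add: poly_eval_mult)
    qed
    ultimately show ?thesis by blast
  qed
  then obtain b where b: "\<And>A. A \<in> N \<Longrightarrow> b A \<in> hom (int k)"
    "\<And>A A'. A \<in> N \<Longrightarrow> A' \<in> N \<Longrightarrow> poly_eval (b A) (node A') = (if A = A' then 1 else 0)"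
    by metis
  note * = card_basis_modulo[where p = node and b = b, OF N(1) W b(1) b(2)]
  show ?thesis
    unfolding hilbert_function_def hom_part_eq_hom
    by (rule the_equality) (use * N(2) in metis)+
qed

lemma global_tjurina_eq: "global_tjurina (L I) = card I choose 2"
  unfolding global_tjurina_def
proof (rule the_equality)
  have *: "\<forall>\<^sub>F k in sequentially. hilbert_function (jacobian_ideal (L I)) k = card I choose 2"
    using hilbert_function_eq by (auto simp: eventually_sequentially)
  then show "\<forall>\<^sub>F k in sequentially. hilbert_function (jacobian_ideal (L I)) k = card I choose 2" .
  fix t assume "\<forall>\<^sub>F k in sequentially. hilbert_function (jacobian_ideal (L I)) k = t"
  with * have "\<forall>\<^sub>F k in sequentially. t = card I choose 2"
    by eventually_elim simp
  then show "t = card I choose 2" by simp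
qed

end

section \<open>The minimal degree of a Jacobian syzygy\<close>

context arrangement
begin

lemma AR_iff:
  "s \<in> AR (L I) \<longleftrightarrow> (\<Sum>i\<in>I. (\<Sum>t\<in>UNIV. s $ t * const_poly (a i $ t)) * L (I - {i})) = 0"
  by (simp add: AR_def sum_partial_deriv)

text \<open>At the node of \<open>i\<close> and \<open>j\<close> the vector \<open>D = s\<close> is proportional to the node itself, so all \<open>e m\<close> with
  \<open>m \<noteq> i, j\<close> agree there.\<close>

lemma AR_low_degree:
  assumes s: "s \<in> AR (L I)" "\<And>t. s $ t \<in> hom k" and k: "k < int (card I) - 2"
  shows "s = 0"
proof -
  \<comment> \<open>The form \<open>\<theta> i\<close> is the value of the derivation on
    \<open>lform (a i)\<close>.\<close>
  define \<theta> where "\<theta> i = (\<Sum>t\<in>UNIV. s $ t * const_poly (a i $ t))" for i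
  have \<theta>_hom: "\<theta> i \<in> hom k" for i
    unfolding \<theta>_def using s(2) by (auto intro!: hom_sum hom_mult' hom_const)
  have eval_\<theta>: "poly_eval (\<theta> i) x = dot (a i) (\<chi> t. poly_eval (s $ t) x)" for i x
    by (simp add: \<theta>_def dot_def poly_eval_simps mult.commute)
  have sum0: "(\<Sum>i\<in>I. \<theta> i * L (I - {i})) = 0"
    using s(1) by (simp add: AR_iff \<theta>_def)
  have "\<exists>e. \<theta> i = lform (a i) * e \<and> e \<in> hom (k - 1)" if i: "i \<in> I" for i
  proof -
    have "poly_eval (L (I - {i}) * \<theta> i) x = 0" if x: "dot (a i) x = 0" for x
    proof -
      \<comment> \<open>On the line \<open>i\<close> every summand of the syzygy except the one for
        \<open>i\<close> contains the factor \<open>lform (a i)\<close>.\<close>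
      have "poly_eval (L (I - {j})) x = 0" if "j \<in> I - {i}" for j
        using that x i by (subst eval_L_eq_0_iff) auto
      then have "poly_eval (\<Sum>j\<in>I. \<theta> j * L (I - {j})) x = poly_eval (L (I - {i}) * \<theta> i) x"
        using finite_I i by (simp add: poly_eval_simps sum.remove[of I i])
      then show ?thesis by (simp add: sum0)
    qed
    then show ?thesis using lform_dvd_cancel[OF i order_refl \<theta>_hom] by metis
  qed
  then obtain e where e: "\<And>i. i \<in> I \<Longrightarrow> \<theta> i = lform (a i) * e i" "\<And>i. i \<in> I \<Longrightarrow> e i \<in> hom (k - 1)"
    by metis
  have eq: "e m = e n" if mn: "m \<in> I" "n \<in> I" "m \<noteq> n" for m n
  proof -
    let ?K = "I - {m, n}"
    have c: "card ?K = card I - 2" using mn finite_I by (simp add: card_Diff_subset)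
    then have "?K \<noteq> {}" using card_I by force
    moreover have "e m - e n \<in> hom (k - 1)" using e(2) mn by (intro hom_diff)
    moreover have "poly_eval (e m - e n) (node {i, j}) = 0" if "i \<in> ?K" "j \<in> ?K" "i \<noteq> j" for i j
    proof -
      let ?p = "node {i, j}"
      define D where "D = (\<chi> t. poly_eval (s $ t) ?p)"
      have ij: "i \<in> I" "j \<in> I" "i \<noteq> j" using that by auto
      have D: "dot (a l) D = dot (a l) ?p * poly_eval (e l) ?p" if "l \<in> I" for l
        using eval_\<theta>[of l ?p] e(1)[OF that] by (simp add: D_def poly_eval_mult)
      have "tri (a i) (a j) (a m)" using generic that mn by auto
      then have "D = poly_eval (e m) ?p *s ?p"
        by (rule tri_eqI) (use D ij mn in \<open>simp_all add: node_left node_right dot_scale\<close>)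
      then have "dot (a n) ?p * poly_eval (e n) ?p = poly_eval (e m) ?p * dot (a n) ?p"
        using D[OF mn(2)] by (metis dot_scale)
      moreover have "dot (a n) ?p \<noteq> 0" using node_other[OF ij mn(2)] that by auto
      ultimately show ?thesis by (simp add: poly_eval_diff)
    qed
    ultimately obtain q where q: "\<forall>i\<in>?K. q i \<in> hom (k - 1 - int (card ?K) + 1)"
      "e m - e n = (\<Sum>i\<in>?K. L (?K - {i}) * q i)"
      using star_ideal[of ?K "e m - e n" "k - 1"] by blast
    \<comment> \<open>The degree of \<open>q i\<close> is \<open>k - (card I - 2)\<close>, which is
      negative.\<close>
    have "q i = 0" if "i \<in> ?K" for i
      using hom_negD[of "q i" "k - 1 - int (card ?K) + 1"] q(1) that c k card_I by auto
    then show ?thesis using q(2) by simp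
  qed
  obtain m where m: "m \<in> I" using card_I by fastforce
  \<comment> \<open>With all \<open>e i\<close> equal the syzygy reads \<open>card I\<close> times
    \<open>e m * L I\<close>, and the ring is a domain of characteristic 0.\<close>
  have "(\<Sum>i\<in>I. \<theta> i * L (I - {i})) = (\<Sum>i\<in>I. e m * L I)"
  proof (rule sum.cong)
    fix i assume i: "i \<in> I"
    then have "e i = e m" using eq m by blast
    then show "\<theta> i * L (I - {i}) = e m * L I"
      using L_remove[OF order_refl i] e(1)[OF i] by (simp add: algebra_simps)
  qed simp
  then have "of_nat (card I) * (e m * L I) = 0" using sum0 by simp
  then have "e m = 0" using card_I L_nonzero[of I] by auto
  then have \<theta>0: "\<theta> i = 0" if "i \<in> I" for i
    using e(1)[OF that] eq[OF m that] by (cases "m = i") auto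
  have "\<not> I \<subseteq> {m}" using card_mono[of "{m}" I] card_I by auto
  then obtain n where n: "n \<in> I" "m \<noteq> n" by blast
  then obtain l where l: "l \<in> I" "tri (a m) (a n) (a l)" using third_line m by metis
  \<comment> \<open>The derivation kills three independent linear forms, hence every
    coordinate.\<close>
  have "s $ t = 0" for t
  proof -
    obtain \<alpha> \<beta> \<gamma> where *: "axis t 1 = \<alpha> *s a m + \<beta> *s a n + \<gamma> *s a l"
      using tri_span[OF l(2)] by blast
    have "s $ t = (\<Sum>r\<in>UNIV. if r = t then s $ t else 0)" by simp
    also have "\<dots> = (\<Sum>r\<in>UNIV. s $ r * const_poly (axis t 1 $ r))"
      by (rule sum.cong) (auto simp: axis_def)
    also have "\<dots> = const_poly \<alpha> * \<theta> m + const_poly \<beta> * \<theta> n + const_poly \<gamma> * \<theta> l"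
      unfolding * by (simp add: \<theta>_def sum.distrib sum_distrib_left const_poly_add const_poly_mult algebra_simps)
    finally show ?thesis using \<theta>0 m n l by simp
  qed
  then show ?thesis by (simp add: vec_eq_iff)
qed

text \<open>The derivative of \<open>f\<close> in the direction \<open>p\<close> of a node is divisible by both lines through the node,
  so \<open>f / (l\<^sub>i l\<^sub>j) \<cdot> \<partial>\<^sub>p\<close> can be corrected by a multiple of the Euler field.\<close>

lemma AR_syzygy: "\<exists>s\<in>AR (L I). s \<noteq> 0 \<and> (\<forall>t. s $ t \<in> hom (int (card I) - 2))"
proof -
  obtain i where i: "i \<in> I" using card_I by fastforce
  have "\<not> I \<subseteq> {i}" using card_mono[of "{i}" I] card_I by auto
  then obtain j where j: "j \<in> I" "i \<noteq> j" by blast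
  note ij = i j
  define K where "K = I - {i, j}"
  define p where "p = node {i, j}"
  \<comment> \<open>The factor makes \<open>r * h\<close> times the Euler field send
    \<open>L I\<close> to \<open>h * L I\<close>.\<close>
  define r :: complex where "r = 1 / of_nat (card I)"
  have K: "K \<subseteq> I" "finite K" using finite_I by (auto simp: K_def)
  have c: "card K = card I - 2" using ij finite_I by (simp add: card_Diff_subset K_def)
  \<comment> \<open>This is the derivative of \<open>L K\<close> in direction \<open>p\<close>, that
    is, the derivative of \<open>L I\<close> divided by the two lines through \<open>p\<close>,
    whose own derivatives in that direction vanish.\<close>
  define h where "h = (\<Sum>m\<in>K. const_poly (dot (a m) p) * L (K - {m}))"
  have "L (K - {m}) \<in> hom (int (card I) - 3)" if "m \<in> K" for m
    using L_hom[of "K - {m}"] K c that card_I by (auto simp: of_nat_diff)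
  then have h_hom: "h \<in> hom (int (card I) - 3)"
    unfolding h_def by (intro hom_sum hom_const_mult)
  have L_hom': "L K \<in> hom (int (card I) - 2)"
    using L_hom[OF K(1)] c card_I by (simp add: of_nat_diff)
  define s :: "poly3 ^ 3" where "s = (\<chi> t. L K * const_poly (p $ t) - const_poly r * h * var t)"
  have \<theta>: "(\<Sum>t\<in>UNIV. s $ t * const_poly (a m $ t)) =
    L K * const_poly (dot (a m) p) - const_poly r * h * lform (a m)" for m
    unfolding sum_const_mult[symmetric] sum_var_mult[symmetric]
    by (simp add: s_def algebra_simps sum_subtractf sum_distrib_left)
  have "(\<Sum>m\<in>I. L K * const_poly (dot (a m) p) * L (I - {m})) =
    (\<Sum>m\<in>K. L K * const_poly (dot (a m) p) * L (I - {m}))"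
  proof (rule sum.mono_neutral_right)
    show "\<forall>m\<in>I - K. L K * const_poly (dot (a m) p) * L (I - {m}) = 0"
      using ij by (auto simp: K_def p_def node_left node_right)
  qed (use finite_I K in auto)
  also have "\<dots> = (\<Sum>m\<in>K. L I * (const_poly (dot (a m) p) * L (K - {m})))"
  proof (rule sum.cong)
    fix m assume "m \<in> K"
    then have "L K * L (I - {m}) = L I * L (K - {m})"
      unfolding K_def by (intro L_mult_swap) auto
    then show "L K * const_poly (dot (a m) p) * L (I - {m}) =
      L I * (const_poly (dot (a m) p) * L (K - {m}))"
      by (simp add: algebra_simps)
  qed simp
  finally have 1: "(\<Sum>m\<in>I. L K * const_poly (dot (a m) p) * L (I - {m})) = L I * h"
    by (simp add: h_def sum_distrib_left)
  have "(\<Sum>m\<in>I. const_poly r * h * lform (a m) * L (I - {m})) = (\<Sum>m\<in>I. const_poly r * h * L I)"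
    by (rule sum.cong) (simp_all add: L_remove[OF order_refl] mult.assoc)
  also have "\<dots> = const_poly (of_nat (card I) * r) * (h * L I)"
    by (simp add: const_poly_mult const_poly_of_nat algebra_simps)
  also have "of_nat (card I) * r = 1" using card_I by (auto simp: r_def)
  finally have 2: "(\<Sum>m\<in>I. const_poly r * h * lform (a m) * L (I - {m})) = L I * h"
    by (simp add: mult.commute)
  have "s \<in> AR (L I)"
    unfolding AR_iff \<theta> left_diff_distrib sum_subtractf 1 2 by simp
  moreover have "s \<noteq> 0"
  proof
    assume s0: "s = 0"
    \<comment> \<open>On the linear form of a line through \<open>p\<close> only the Euler part
      acts, so \<open>h = 0\<close>; what is left of the syzygy is \<open>L K\<close> times the
      nonzero vector \<open>p\<close>.\<close>
    then have "const_poly r * h * lform (a i) = 0"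
      using \<theta>[of i] ij by (simp add: p_def node_left)
    moreover have "lform (a i) \<noteq> 0" using L_nonzero[of "{i}"] i by (simp add: L_def)
    moreover have "r \<noteq> 0" using card_I by (auto simp: r_def)
    ultimately have "h = 0" by simp
    moreover have "L K \<noteq> 0" using L_nonzero K by blast
    ultimately have "p $ t = 0" for t
      using arg_cong[OF s0, of "\<lambda>s. s $ t"] by (simp add: s_def)
    then show False using node_nonzero[OF ij] by (simp add: p_def vec_eq_iff)
  qed
  moreover have "s $ t \<in> hom (int (card I) - 2)" for t
  proof -
    have "const_poly r * h * var t \<in> hom (int (card I) - 2)"
      unfolding var_def by (rule hom_mult'[OF hom_const_mult[OF h_hom] hom_lform]) simp
    moreover have "L K * const_poly (p $ t) \<in> hom (int (card I) - 2)"
      by (rule hom_mult'[OF L_hom' hom_const]) simp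
    ultimately show ?thesis by (simp add: s_def hom_diff)
  qed
  ultimately show ?thesis by blast
qed

lemma mdr_eq: "mdr (L I) = card I - 2"
  unfolding mdr_def
proof (rule Least_equality)
  show "\<exists>s\<in>AR (L I). s \<noteq> 0 \<and> (\<forall>t. s $ t \<in> hom_part (card I - 2))"
    using AR_syzygy card_I by (simp add: hom_part_eq_hom of_nat_diff)
  fix k assume "\<exists>s\<in>AR (L I). s \<noteq> 0 \<and> (\<forall>t. s $ t \<in> hom_part k)"
  then obtain s where "s \<in> AR (L I)" "s \<noteq> 0" "\<And>t. s $ t \<in> hom (int k)"
    by (auto simp: hom_part_eq_hom)
  then show "card I - 2 \<le> k" using AR_low_degree[of s "int k"] by force
qed

end

section \<open>Reduced equations of generic arrangements\<close>

text \<open>The fundamental theorem of algebra gives a zero in the chart \<open>v + t *s w\<close>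
  unless the form is constant there. In that case it is a multiple of \<open>t ^ k\<close> in the
  chart around \<open>w\<close>, and positive degree makes it vanish at \<open>w\<close>
  itself.\<close>

lemma form_zero_on_line:
  assumes vw: "line_basis m v w" and h: "h \<in> hom (int k)" "0 < k"
  obtains x where "x \<noteq> 0" "dot m x = 0" "poly_eval h x = 0"
proof -
  obtain P where P: "\<And>t. poly P t = poly_eval h (v + t *s w)" using poly_eval_line by blast
  obtain Q where Q: "\<And>t. poly Q t = poly_eval h (w + t *s v)" using poly_eval_line by blast
  show ?thesis
  proof (cases "constant (poly P)")
    case False
    then obtain t where "poly P t = 0" using fundamental_theorem_of_algebra by blast
    then show ?thesis
      using that[of "v + t *s w"] P line_basis_dot[OF vw] line_basis_nonzero(1)[OF vw] by simp
  next
    case True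
    then obtain c where c: "\<And>t. poly P t = c" unfolding constant_def by blast
    have "poly Q t = c * t ^ k" if "t \<noteq> 0" for t
    proof -
      have "w + t *s v = t *s (v + (1 / t) *s w)"
        using that by (simp add: vec_eq_iff field_simps)
      then have "poly Q t = t ^ k * poly_eval h (v + (1 / t) *s w)"
        unfolding Q by (simp only: poly_eval_scale[OF h(1)])
      then show ?thesis using P[of "1 / t"] c by simp
    qed
    then have "UNIV - {0} \<subseteq> {t. poly (Q - monom c k) t = 0}" by (auto simp: poly_monom)
    then have "infinite {t. poly (Q - monom c k) t = 0}"
      by (metis finite_subset finite_Diff2 finite.emptyI finite.insertI infinite_UNIV_char_0)
    then have "Q = monom c k" using poly_roots_finite by (metis eq_iff_diff_eq_0)
    then have "poly Q 0 = 0" using h(2) by (simp add: poly_monom)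
    then have "poly_eval h w = 0" by (simp add: Q)
    moreover have "dot m w = 0" using vw by (auto simp: line_basis_def)
    ultimately show ?thesis using that line_basis_nonzero(2)[OF vw] by blast
  qed
qed

text \<open>Along the conic of covectors \<open>(1, t, t^2)\<close> each point of \<open>Z\<close>
  excludes only the roots of a nonzero polynomial of degree at most two.\<close>

lemma line_avoiding_finite_set:
  assumes "finite Z" "0 \<notin> Z"
  obtains m where "m \<noteq> 0" "\<And>z. z \<in> Z \<Longrightarrow> dot m z \<noteq> 0"
proof -
  have "finite {t. dot (vector [1, t, t\<^sup>2]) z = 0}" if "z \<in> Z" for z
  proof -
    have "z \<noteq> 0" using assms that by auto
    then have "[:z $ 1, z $ 2, z $ 3:] \<noteq> 0" by (auto simp: vec_eq_iff forall_3)
    then have "finite {t. poly [:z $ 1, z $ 2, z $ 3:] t = 0}" by (rule poly_roots_finite)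
    moreover have "dot (vector [1, t, t\<^sup>2]) z = poly [:z $ 1, z $ 2, z $ 3:] t" for t
      by (simp add: dot_def sum_3 power2_eq_square algebra_simps)
    ultimately show ?thesis by simp
  qed
  then have "finite (\<Union>z\<in>Z. {t. dot (vector [1, t, t\<^sup>2]) z = 0})" using assms(1) by blast
  then obtain t where "t \<notin> (\<Union>z\<in>Z. {t. dot (vector [1, t, t\<^sup>2]) z = 0})"
    using ex_new_if_finite[OF infinite_UNIV_char_0] by blast
  moreover have "(vector [1, t, t\<^sup>2] :: complex ^ 3) \<noteq> 0"
    by (simp add: vec_eq_iff forall_3)
  ultimately show ?thesis using that by blast
qed

context arrangement
begin

lemma a_nonzero: "i \<in> I \<Longrightarrow> a i \<noteq> 0"
  using L_nonzero[of "{i}"] by (auto simp: L_def lform_def)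

text \<open>Lines are divided out one at a time: the product already split off is not identically
  zero on the next line, so the cofactor vanishes on it.\<close>

lemma L_dvd:
  assumes f: "f \<in> hom k" and zero: "\<And>i x. i \<in> I \<Longrightarrow> x \<noteq> 0 \<Longrightarrow> dot (a i) x = 0 \<Longrightarrow> poly_eval f x = 0"
  obtains h where "f = L I * h" "h \<in> hom (k - int (card I))"
proof -
  have "\<exists>h. f = L K * h \<and> h \<in> hom (k - int (card K))" if "finite K" "K \<subseteq> I" for K
    using that
  proof induction
    case empty
    show ?case using f by (simp add: L_def)
  next
    case (insert i K)
    then obtain h where h: "f = L K * h" "h \<in> hom (k - int (card K))" by auto
    have i: "i \<in> I" "K \<subseteq> I - {i}" using insert by auto
    then obtain u where "h = lform (a i) * u" "u \<in> hom (k - int (card K) - 1)"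
      using lform_dvd_cancel[OF i h(2)] zero h(1) by metis
    then show ?case
      using h(1) insert by (intro exI[of _ u]) (auto simp: L_insert algebra_simps)
  qed
  then show ?thesis using that finite_I by blast
qed

text \<open>A cofactor \<open>h\<close> of positive degree would meet every line of the plane. It has only finitely many
  zeros, since these lie on the arrangement and by squarefreeness \<open>h\<close> vanishes on none of its lines;
  a general line misses them.\<close>

lemma cofactor_degree:
  assumes sqf: "squarefree (L I * h)" and h: "h \<in> hom k"
    and zero: "\<And>x. x \<noteq> 0 \<Longrightarrow> poly_eval (L I * h) x = 0 \<Longrightarrow> \<exists>i\<in>I. dot (a i) x = 0"
  shows "k \<le> 0"
proof (rule ccontr)
  assume k: "\<not> k \<le> 0"
  have not_dvd: "h \<noteq> lform (a i) * u" if i: "i \<in> I" for i u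
  proof
    assume "h = lform (a i) * u"
    then have "L I * h = lform (a i) ^ 2 * (L (I - {i}) * u)"
      using L_remove[OF order_refl i] by (simp add: power2_eq_square algebra_simps)
    then have "lform (a i) dvd 1"
      using sqf unfolding squarefree_def by (metis dvd_triv_left)
    then obtain q where "1 = lform (a i) * q" by (rule dvdE)
    \<comment> \<open>A linear form vanishes at the origin and so is not a unit.\<close>
    then have "poly_eval 1 0 = poly_eval (lform (a i) * q) 0" by simp
    then show False by (simp add: poly_eval_mult)
  qed
  have "\<exists>v w. line_basis (a i) v w" if "i \<in> I" for i
    using line_basis_exists[OF a_nonzero[OF that]] by metis
  then obtain v w where vw: "\<And>i. i \<in> I \<Longrightarrow> line_basis (a i) (v i) (w i)" by metis
  define T where "T i = {t. poly_eval h (v i + t *s w i) = 0}" for i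
  have T: "finite (T i)" if "i \<in> I" for i
    using lform_dvd_of_infinite[OF vw[OF that] h] not_dvd[OF that] unfolding T_def by metis
  \<comment> \<open>The set represents all zeros of \<open>h\<close> on the arrangement;
    \<open>w i\<close>, the point missed by the parametrization, is included whether or not
    \<open>h\<close> vanishes there.\<close>
  define Z where "Z = (\<Union>i\<in>I. insert (w i) ((\<lambda>t. v i + t *s w i) ` T i))"
  have "finite Z" using T finite_I by (auto simp: Z_def)
  moreover have "0 \<notin> Z"
  proof
    assume "0 \<in> Z"
    then obtain i where "i \<in> I" "w i = 0 \<or> (\<exists>t. v i + t *s w i = 0)" by (auto simp: Z_def) metis
    then show False using line_basis_nonzero[OF vw] by blast
  qed
  ultimately obtain m where m: "m \<noteq> 0" "\<And>z. z \<in> Z \<Longrightarrow> dot m z \<noteq> 0"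
    using line_avoiding_finite_set by blast
  obtain v' w' where "line_basis m v' w'" using line_basis_exists m(1) by blast
  moreover have hk: "h \<in> hom (int (nat k))" "0 < nat k" using h k by auto
  ultimately obtain x where x: "x \<noteq> 0" "dot m x = 0" "poly_eval h x = 0"
    using form_zero_on_line by blast
  have "poly_eval (L I * h) x = 0" using x(3) by (simp add: poly_eval_mult)
  then obtain i where i: "i \<in> I" "dot (a i) x = 0" using zero x(1) by blast
  obtain \<alpha> \<beta> where ab: "x = \<alpha> *s v i + \<beta> *s w i" using line_basis_span[OF vw[OF i(1)] i(2)] .
  have "\<exists>c z. x = c *s z \<and> z \<in> Z"
  proof (cases "\<alpha> = 0")
    case True
    then have "x = \<beta> *s w i" by (simp add: ab)
    then show ?thesis using i(1) by (auto simp: Z_def)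
  next
    case False
    then have *: "x = \<alpha> *s (v i + (\<beta> / \<alpha>) *s w i)"
      by (simp add: ab vec_eq_iff field_simps)
    then have "\<alpha> ^ nat k * poly_eval h (v i + (\<beta> / \<alpha>) *s w i) = 0"
      using x(3) poly_eval_scale[OF hk(1)] by metis
    then have "\<beta> / \<alpha> \<in> T i" using False by (simp add: T_def)
    then have "v i + (\<beta> / \<alpha>) *s w i \<in> Z" using i(1) by (auto simp: Z_def)
    then show ?thesis using * by blast
  qed
  then obtain c z where cz: "x = c *s z" "z \<in> Z" by blast
  then have "c \<noteq> 0" using x(1) by auto
  then show False using x(2) m(2)[OF cz(2)] cz(1) by (simp add: dot_scale)
qed

end

lemma arrangement_of_lines:
  assumes "finite S" "4 \<le> card S"
    and "\<And>l. l \<in> S \<Longrightarrow> l = {v. v \<noteq> 0 \<and> dot (a l) v = 0}"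
    and "\<forall>l1\<in>S. \<forall>l2\<in>S. \<forall>l3\<in>S. l1 \<noteq> l2 \<and> l1 \<noteq> l3 \<and> l2 \<noteq> l3 \<longrightarrow> l1 \<inter> l2 \<inter> l3 = {}"
  shows "arrangement S a"
proof
  fix i j k assume ijk: "i \<in> S" "j \<in> S" "k \<in> S" "i \<noteq> j" "i \<noteq> k" "j \<noteq> k"
  have "v \<in> l" if "l \<in> S" "v \<noteq> 0" "dot (a l) v = 0" for l v
    using assms(3)[OF that(1)] that by blast
  moreover have "i \<inter> j \<inter> k = {}" using assms(4) ijk by blast
  ultimately show "tri (a i) (a j) (a k)"
    unfolding tri_def using ijk by (metis IntI empty_iff)
qed fact+

text \<open>The lines themselves serve as index set. The cofactor of their product in
  \<open>f\<close> has degree at most 0 by \<open>cofactor_degree\<close> and is nonzero, hence is a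
  constant, and \<open>n = d\<close> comes out along the way.\<close>

lemma generic_arrangement_equation:
  assumes d: "4 \<le> d" and gen: "generic_line_arrangement d C" and red: "reduced_plane_curve n f"
    and C: "C = proj_zeros f"
  obtains S and a :: "(complex ^ 3) set \<Rightarrow> complex ^ 3"
    where "arrangement S a" "card S = d" "f = arrangement.L a S"
proof -
  obtain S where S: "finite S" "card S = d" "\<And>l. l \<in> S \<Longrightarrow> proj_line l" "C = \<Union>S"
    "\<forall>l1\<in>S. \<forall>l2\<in>S. \<forall>l3\<in>S. l1 \<noteq> l2 \<and> l1 \<noteq> l3 \<and> l2 \<noteq> l3 \<longrightarrow> l1 \<inter> l2 \<inter> l3 = {}"
    using gen unfolding generic_line_arrangement_def by blast
  have "\<forall>l\<in>S. \<exists>b. l = {v. v \<noteq> 0 \<and> dot b v = 0}"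
    using S(3) unfolding proj_line_def dot_def by blast
  from bchoice[OF this] obtain a where a: "\<And>l. l \<in> S \<Longrightarrow> l = {v. v \<noteq> 0 \<and> dot (a l) v = 0}"
    by blast
  interpret arrangement S a
    by (rule arrangement_of_lines) (use S d a in auto)
  have f: "f \<in> hom (int n)" and sqf: "squarefree f"
    using red by (auto simp: reduced_plane_curve_def hom_part_eq_hom)
  have zeros: "poly_eval f x = 0 \<longleftrightarrow> (\<exists>l\<in>S. dot (a l) x = 0)" if "x \<noteq> 0" for x
  proof -
    have "poly_eval f x = 0 \<longleftrightarrow> x \<in> \<Union>S" using C S(4) that by (auto simp: proj_zeros_def)
    also have "\<dots> \<longleftrightarrow> (\<exists>l\<in>S. dot (a l) x = 0)" using a that by blast
    finally show ?thesis .
  qed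
  obtain h where h: "f = L S * h" "h \<in> hom (int n - int d)"
    using L_dvd[OF f] zeros S(2) by metis
  have "f \<noteq> 0" using sqf by auto
  then have "h \<noteq> 0" using h(1) by auto
  have "int n - int d \<le> 0"
    by (rule cofactor_degree[OF _ h(2)]) (use sqf zeros h(1) in auto)
  moreover have "0 \<le> int n - int d" using hom_negD[OF h(2)] \<open>h \<noteq> 0\<close> by force
  ultimately have "h \<in> hom 0" using h(2) by simp
  then obtain c where c: "h = const_poly c" using hom_0_const by blast
  then have "c \<noteq> 0" using \<open>h \<noteq> 0\<close> by auto
  have "S \<noteq> {}" using S(2) d by auto
  then obtain l where l: "l \<in> S" by blast
  \<comment> \<open>The constant is absorbed by rescaling one linear form, which does not change its
    line.\<close>
  define a' where "a' = a(l := c *s a l)"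
  have "m = {v. v \<noteq> 0 \<and> dot (a' m) v = 0}" if "m \<in> S" for m
    using a[OF that] \<open>c \<noteq> 0\<close> by (cases "m = l") (auto simp: a'_def dot_scale_left)
  then have arr: "arrangement S a'"
    by (intro arrangement_of_lines) (use S d in auto)
  have "(\<Prod>m\<in>S - {l}. lform (a' m)) = L (S - {l})"
    unfolding L_def by (rule prod.cong) (auto simp: a'_def)
  then have "arrangement.L a' S = lform (a' l) * L (S - {l})"
    unfolding arrangement.L_def[OF arr] using prod.remove[OF S(1) l] by metis
  also have "\<dots> = f"
    using L_remove[OF order_refl l] by (simp add: h(1) c a'_def lform_scale algebra_simps)
  finally show ?thesis using that[OF arr S(2)] by simp
qed

text \<open>For \<open>r = d - 2\<close> the subtracted binomial is \<open>(d - 2) choose 2\<close>.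
  Doubling leaves a polynomial identity, and the substitution \<open>d = e + 2\<close> removes the
  truncated subtractions.\<close>

lemma tjurina_max_eq: assumes "4 \<le> d" shows "tjurina_max d (d - 2) = int (d choose 2)"
proof -
  define e where "e = d - 2"
  have e: "d = e + 2" using assms by (simp add: e_def)
  have two: "2 * int (n choose 2) = int n * (int n - 1)" for n
    by (induction n) (auto simp: numeral_2_eq_2 algebra_simps)
  have "2 * tjurina_max d (d - 2) = 2 * int (d choose 2)"
    using two[of e] two[of d] by (simp add: tjurina_max_def e power2_eq_square algebra_simps)
  then show ?thesis by simp
qed

theorem proposition4p11:
  fixes d n :: nat and f :: poly3 and C :: "(complex ^ 3) set"
  assumes "d \<ge> 4"
    and "generic_line_arrangement d C"
    and "reduced_plane_curve n f"
    and "C = proj_zeros f"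
  shows "maximal_tjurina_curve d (d - 2) f"
proof -
  obtain S and a :: "(complex ^ 3) set \<Rightarrow> complex ^ 3"
    where arr: "arrangement S a" and S: "card S = d" and f: "f = arrangement.L a S"
    using generic_arrangement_equation[OF assms] .
  interpret arrangement S a by (rule arr)
  have "f \<in> hom_part d" using L_hom[of S] S by (simp add: f hom_part_eq_hom)
  moreover have "squarefree f" using assms(3) by (simp add: reduced_plane_curve_def)
  ultimately have "reduced_plane_curve d f" using assms(1) by (simp add: reduced_plane_curve_def)
  then show ?thesis
    using assms(1) mdr_eq global_tjurina_eq tjurina_max_eq[OF assms(1)] S
    by (auto simp: maximal_tjurina_curve_def f)
qed

end
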